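(* Let $a\in\mathbb{R}$ and $\lambda>0$, and for $k=0,1,2,\ldots$ let $\psi_k$ be the eigenfunction of the eigenvalue problem $$-\psi''(x)+\Big(ax^2+\frac{\lambda}{2}x^4\Big)\psi(x)=E\psi(x),\quad x\in\mathbb{R},\qquad \lim_{x\to\pm\infty}\psi(x)=0,$$ belonging to the $k$-th eigenvalue $E_k$ (where $E_0<E_1<\cdots$), normalised by $$\psi_k(x)\sim x^{-1}\exp\Big(-\frac{(\lambda/2)^{1/2}}{3}x^3-\frac{a}{2(\lambda/2)^{1/2}}x\Big),\quad x\to+\infty.$$ Define $$\mathcal{K}(a,\lambda;x,y,z)=\lambda^{1/3}\exp\big((\lambda/2)^{1/2}xyz\big)\,\mathrm{Ai}\Big(\frac{\lambda^{1/3}}{2}(x^2+y^2+z^2)+\frac{a}{\lambda^{2/3}}\Big).$$ Then for every $k=0,1,2,\ldots$ and all $x,y\in\mathbb{R}$, $$\psi_k(x)\psi_k(y)=\int_{\mathbb{R}}\psi_k(z)\,\mathcal{K}(a,\lambda;x,y,z)\,dz.$$ Moreover, if $a>\lambda^{2/3}a_1$, where $a_1=-2.3381074105\ldots$ is the first (largest) zero of $\mathrm{Ai}$, then $\mathcal{K}(a,\lambda;x,y,z)>0$ for all $x,y,z\in\mathbb{R}$.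
   Context: $\mathrm{Ai}$ denotes the standard Airy function, the solution of $w''(x)=xw(x)$ given by $\mathrm{Ai}(x)=\frac{1}{2\pi i}\int_{\infty e^{-i\pi/3}}^{\infty e^{i\pi/3}}\exp(\zeta^3/3-\zeta x)\,d\zeta$. The eigenvalue problem stated has a discrete spectrum of real simple eigenvalues $E_0<E_1<\cdots\to\infty$; for each $E_k$ there is a unique solution with the stated asymptotic behaviour as $x\to+\infty$ (its derivative having the asymptotics given by differentiating the right-hand side), and this is $\psi_k$. *)

theory Defs
  imports "HOL-Analysis.Analysis" "HOL-Library.Landau_Symbols"
begin

text \<open>Airy function, defined by the contour integral
  Ai(x) = 1/(2 pi i) int_{infty e^{-i pi/3}}^{infty e^{i pi/3}} exp(zeta^3/3 - zeta x) d zeta,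
  where the contour is the two rays through the origin, parametrised as
  zeta = r cis(-pi/3) (r from infinity down to 0) followed by zeta = r cis(pi/3)
  (r from 0 to infinity).\<close>

definition airy_integrand :: "real \<Rightarrow> complex \<Rightarrow> complex" where
  "airy_integrand x \<zeta> = exp (\<zeta> ^ 3 / 3 - \<zeta> * complex_of_real x)"

definition Airy_Ai :: "real \<Rightarrow> real" where
  "Airy_Ai x = Re ((1 / (2 * complex_of_real pi * \<i>)) *
     ((LINT r:{0..}|lborel. airy_integrand x (complex_of_real r * cis (pi/3)) * cis (pi/3))
    - (LINT r:{0..}|lborel. airy_integrand x (complex_of_real r * cis (-(pi/3))) * cis (-(pi/3)))))"

definition airy_a1 :: real where
  "airy_a1 = (GREATEST t. Airy_Ai t = 0)"

definition quartic_kernel :: "real \<Rightarrow> real \<Rightarrow> real \<Rightarrow> real \<Rightarrow> real \<Rightarrow> real" where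
  "quartic_kernel a lam x y z =
     lam powr (1/3) * exp (sqrt (lam/2) * x * y * z) *
     Airy_Ai (lam powr (1/3) / 2 * (x^2 + y^2 + z^2) + a / lam powr (2/3))"

definition normalised_eigenfunction :: "real \<Rightarrow> real \<Rightarrow> real \<Rightarrow> (real \<Rightarrow> real) \<Rightarrow> bool" where
  "normalised_eigenfunction a lam E \<psi> \<longleftrightarrow>
     (\<exists>\<psi>'. \<forall>x. (\<psi> has_real_derivative \<psi>' x) (at x) \<and>
        (\<psi>' has_real_derivative ((a * x^2 + lam/2 * x^4 - E) * \<psi> x)) (at x)) \<and>
     (\<psi> \<longlongrightarrow> 0) at_top \<and> (\<psi> \<longlongrightarrow> 0) at_bot \<and>
     \<psi> \<sim>[at_top] (\<lambda>x. inverse x *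
        exp (- (sqrt (lam/2) / 3) * x^3 - a / (2 * sqrt (lam/2)) * x))"

end

theory Submission
  imports Defs "HOL-Complex_Analysis.Cauchy_Integral_Theorem" "HOL-Probability.Distributions"
    "HOL-Real_Asymp.Real_Asymp"
begin

text \<open>Write \<open>\<lambda> = 8 b\<^sup>6\<close> and fix \<open>x\<close>. The kernel satisfies \<open>(\<partial>\<^sub>y\<^sup>2 - V y) \<K> = (\<partial>\<^sub>z\<^sup>2 - V z) \<K>\<close>, so integration by
  parts shows that \<open>F y = \<integral> \<psi> z \<K> x y z dz\<close> solves the same equation as \<open>\<psi>\<close>. Moving the Airy contour
  to \<open>Re \<zeta> = b y\<close> turns \<open>\<K> x y z\<close> exactly into the normalising function of \<open>\<psi> y\<close> times an
  approximate identity \<open>exp (- b\<^sup>3 y (z - x)\<^sup>2)\<close>, whence \<open>F y / \<psi> y\<close> tends to \<open>\<psi> x\<close> as \<open>y\<close> tends to infinity.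
  A solution with this property is \<open>\<psi> x\<close> times \<open>\<psi>\<close>. Positivity of the kernel follows from
  continuity of the Airy function and its positivity near infinity.\<close>

text \<open>The parameter b turns sqrt (\<open>lam\<close> / 2), \<open>lam\<close>^(1/3) and
  \<open>lam\<close>^(2/3) into 2 b^3, 2 b^2 and 4 b^4, so all comparisons of exponents become
  algebra in b. The line Re zeta = b y depends on y but not on z. Hence the exponent on it stays
  quadratic in z, and together with 2 b^3 x y z it completes to the square - b^3 y (z - x)^2 with no
  error term. Two obstacles shape the argument. The normalisation fixes the size of
  \<open>\<psi>\<close> at +infinity but prescribes nothing for its derivative, so the constant
  value of a Wronskian cannot be read off as a limit; the quotient of the two solutions is studied
  instead. And the information sits at one end only, so the identity is first obtained for large y
  and then carried to the left by uniqueness for the differential equation. All interchanges of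
  limits and vanishing boundary terms rest on one crude bound, C exp (- t) for Ai and its
  derivative: the argument of Ai contains b^2 z^2, so this is already Gaussian decay in z, which
  outweighs exp (2 b^3 x y z) and every polynomial factor.\<close>

lemma has_bochner_integral_gaussian:
  fixes b :: real
  assumes "b > 0"
  shows "has_bochner_integral lborel (\<lambda>x. exp (- b * x\<^sup>2)) (sqrt (pi / b))"
proof -
  define s where "s = 1 / sqrt (2 * b)"
  have s: "s > 0" "s\<^sup>2 = 1 / (2 * b)"
    using assms by (auto simp: s_def power_divide)
  have eq: "exp (- b * x\<^sup>2) = sqrt (pi / b) * normal_density 0 s x" for x
    using assms s by (simp add: normal_density_def real_sqrt_divide)
  have "has_bochner_integral lborel (normal_density 0 s) 1"
    using s(1) by (simp add: has_bochner_integral_iff)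
  from has_bochner_integral_mult_right[OF this, of "sqrt (pi / b)"]
  show ?thesis unfolding eq by simp
qed

lemmas integrable_gaussian = has_bochner_integral_gaussian[THEN integrable.intros]
lemmas integral_gaussian = has_bochner_integral_gaussian[THEN has_bochner_integral_integral_eq]

lemma integral_FTC_real_line:
  fixes f F :: "real \<Rightarrow> 'a::euclidean_space"
  assumes F: "\<And>x. (F has_vector_derivative f x) (at x)"
    and f: "continuous_on UNIV f" "integrable lborel f"
    and lim: "(F \<longlongrightarrow> A) at_bot" "(F \<longlongrightarrow> B) at_top"
  shows "(\<integral>x. f x \<partial>lborel) = B - A"
proof -
  have "(LBINT x=-\<infinity>..\<infinity>. f x) = B - A"
  proof (rule interval_integral_FTC_integrable)
    show "isCont f x" for x using f(1) by (simp add: continuous_on_eq_continuous_at)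
    show "set_integrable lborel (einterval (-\<infinity>) \<infinity>) f"
      using f(2) by (simp add: set_integrable_def)
    show "((F \<circ> real_of_ereal) \<longlongrightarrow> A) (at_right (-\<infinity>))"
      using lim(1) by (simp add: ereal_tendsto_simps)
    show "((F \<circ> real_of_ereal) \<longlongrightarrow> B) (at_left \<infinity>)"
      using lim(2) by (simp add: ereal_tendsto_simps)
  qed (auto intro: F)
  then show ?thesis
    by (simp add: interval_lebesgue_integral_def set_lebesgue_integral_def)
qed

lemma has_vector_derivative_iff_tendsto_quotient:
  fixes f :: "real \<Rightarrow> 'a::real_normed_vector"
  shows "(f has_vector_derivative D) (at x) \<longleftrightarrow> ((\<lambda>h. (f (x + h) - f x) /\<^sub>R h) \<longlongrightarrow> D) (at 0)"
proof -
  have eq: "norm (f (x + h) - f x - h *\<^sub>R D) / norm h = norm ((f (x + h) - f x) /\<^sub>R h - D)" if "h \<noteq> 0" for h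
  proof -
    have "f (x + h) - f x - h *\<^sub>R D = h *\<^sub>R ((f (x + h) - f x) /\<^sub>R h - D)"
      using that by (simp add: scaleR_diff_right)
    then show ?thesis using that by simp
  qed
  have "(f has_vector_derivative D) (at x) \<longleftrightarrow>
      ((\<lambda>h. norm (f (x + h) - f x - h *\<^sub>R D) / norm h) \<longlongrightarrow> 0) (at 0)"
    by (simp add: has_vector_derivative_def has_derivative_at bounded_linear_scaleR_left)
  also have "\<dots> \<longleftrightarrow> ((\<lambda>h. norm ((f (x + h) - f x) /\<^sub>R h - D)) \<longlongrightarrow> 0) (at 0)"
    by (intro tendsto_cong) (auto simp: eventually_at_filter eq simp del: real_norm_def)
  also have "\<dots> \<longleftrightarrow> ((\<lambda>h. (f (x + h) - f x) /\<^sub>R h) \<longlongrightarrow> D) (at 0)"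
    by (simp only: tendsto_norm_zero_iff LIM_zero_iff)
  finally show ?thesis .
qed

text \<open>Dominating the derivative on a ball suffices: the mean value inequality passes the bound
  \<open>g\<close> on to the difference quotients, and dominated convergence applies along every
  sequence of increments tending to 0.\<close>

lemma has_vector_derivative_lebesgue_integral:
  fixes f :: "real \<Rightarrow> 'a \<Rightarrow> 'b::{banach,second_countable_topology}"
  assumes d: "d > 0"
    and f': "\<And>y z. dist y y0 < d \<Longrightarrow> ((\<lambda>y. f y z) has_vector_derivative f' y z) (at y)"
    and int: "\<And>y. integrable M (f y)"
    and meas: "f' y0 \<in> borel_measurable M"
    and bound: "\<And>y z. dist y y0 < d \<Longrightarrow> norm (f' y z) \<le> g z" "integrable M g"
  shows "((\<lambda>y. \<integral>z. f y z \<partial>M) has_vector_derivative (\<integral>z. f' y0 z \<partial>M)) (at y0)"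
proof -
  let ?q = "\<lambda>h z. (f (y0 + h) z - f y0 z) /\<^sub>R h"
  have "((\<lambda>h. \<integral>z. ?q h z \<partial>M) \<longlongrightarrow> (\<integral>z. f' y0 z \<partial>M)) (at 0)"
    unfolding tendsto_at_iff_sequentially comp_def
  proof (intro allI impI)
    fix X :: "nat \<Rightarrow> real"
    assume X: "\<forall>i. X i \<in> UNIV - {0}" "X \<longlonglongrightarrow> 0"
    obtain N where N: "\<And>n. n \<ge> N \<Longrightarrow> \<bar>X n\<bar> < d"
      using X(2) d unfolding LIMSEQ_iff by force
    show "(\<lambda>n. \<integral>z. ?q (X n) z \<partial>M) \<longlonglongrightarrow> (\<integral>z. f' y0 z \<partial>M)"
    \<comment> \<open>The increments are known to be smaller than \<open>d\<close> only from index
      \<open>N\<close> on, hence the shift.\<close>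
    proof (rule LIMSEQ_offset[of _ N], rule integral_dominated_convergence)
      show "f' y0 \<in> borel_measurable M" by (fact meas)
      show "(\<lambda>z. ?q (X (n + N)) z) \<in> borel_measurable M" for n
        using int by (intro borel_measurable_scaleR borel_measurable_diff borel_measurable_const)
          (auto dest: borel_measurable_integrable)
      show "integrable M g" by (fact bound(2))
      show "AE z in M. (\<lambda>n. ?q (X (n + N)) z) \<longlonglongrightarrow> f' y0 z"
      proof (rule AE_I2)
        fix z
        have "((\<lambda>h. ?q h z) \<longlongrightarrow> f' y0 z) (at 0)"
          using f'[of y0 z] d by (simp add: has_vector_derivative_iff_tendsto_quotient)
        then show "(\<lambda>n. ?q (X (n + N)) z) \<longlonglongrightarrow> f' y0 z"
          using X unfolding tendsto_at_iff_sequentially comp_def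
          by (intro LIMSEQ_ignore_initial_segment) auto
      qed
      show "AE z in M. norm (?q (X (n + N)) z) \<le> g z" for n
      proof (rule AE_I2)
        fix z
        let ?h = "X (n + N)"
        have h: "\<bar>?h\<bar> < d" using N by simp
        have "norm (f (y0 + ?h) z - f y0 z) \<le> g z * norm (y0 + ?h - y0)"
        proof (rule differentiable_bound)
          show "convex (ball y0 d)" by simp
          show "((\<lambda>y. f y z) has_derivative (\<lambda>t. t *\<^sub>R f' y z)) (at y within ball y0 d)"
            if "y \<in> ball y0 d" for y
            using f'[of y z] that by (auto simp: has_vector_derivative_def dist_commute intro: has_derivative_at_withinI)
          show "onorm (\<lambda>t. t *\<^sub>R f' y z) \<le> g z" if "y \<in> ball y0 d" for y
            using bound(1)[of y z] that
            by (intro onorm_le) (simp add: dist_commute mult.commute[of _ "\<bar>_\<bar>"] mult_left_mono)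
          show "y0 + ?h \<in> ball y0 d" "y0 \<in> ball y0 d"
            using h d by (auto simp: dist_real_def)
        qed
        then show "norm (?q ?h z) \<le> g z"
          using X(1) by (simp add: divide_simps mult.commute)
      qed
    qed
  qed
  moreover have "(\<integral>z. ?q h z \<partial>M) = ((\<integral>z. f (y0 + h) z \<partial>M) - (\<integral>z. f y0 z \<partial>M)) /\<^sub>R h" for h
    using int by (simp only: integral_scaleR_right Bochner_Integration.integral_diff)
  ultimately show ?thesis
    unfolding has_vector_derivative_iff_tendsto_quotient by (simp only:)
qed

subsection \<open>The Airy function on vertical lines\<close>

lemma airy_integrand_has_derivative:
  "(airy_integrand x has_field_derivative (z\<^sup>2 - of_real x) * airy_integrand x z) (at z)"
  unfolding airy_integrand_def[abs_def]
  by (auto intro!: derivative_eq_intros simp: field_simps)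

lemma continuous_on_airy_integrand [continuous_intros]:
  "continuous_on S f \<Longrightarrow> continuous_on S (\<lambda>s. airy_integrand x (f s))"
  unfolding airy_integrand_def by (intro continuous_intros) auto

lemma norm_airy_integrand:
  "norm (airy_integrand x (Complex u v)) = exp (u ^ 3 / 3 - u * v\<^sup>2 - u * x)"
  by (simp add: airy_integrand_def power3_eq_cube power2_eq_square field_simps)

text \<open>The sign \<open>s\<close> lets a single argument cover both rays of the defining
  contour.\<close>

lemma airy_ray_point:
  assumes "s = 1 \<or> s = (-1::real)"
  shows "of_real r * cis (s * (pi/3)) = Complex (r / 2) (s * (r * sqrt 3 / 2))"
  using assms by (auto simp: complex_eq_iff cos_60 sin_60)

lemma set_integrable_airy_ray:
  assumes "s = 1 \<or> s = (-1::real)"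
  shows "set_integrable lborel {0..} (\<lambda>r. airy_integrand x (of_real r * cis (s * (pi/3))) * cis (s * (pi/3)))"
    (is "set_integrable _ _ ?f")
  unfolding set_integrable_def
proof (rule Bochner_Integration.integrable_bound)
  show "integrable lborel (\<lambda>r. exp (32/3 + x\<^sup>2/16) * exp (- 1 * r\<^sup>2))"
    by (intro integrable_mult_right integrable_gaussian) simp
  have "?f \<in> borel_measurable borel"
    by (intro borel_measurable_continuous_onI continuous_intros)
  then show "(\<lambda>r. indicator {0..} r *\<^sub>R ?f r) \<in> borel_measurable lborel"
    by simp
  show "AE r in lborel. norm (indicator {0..} r *\<^sub>R ?f r) \<le> norm (exp (32/3 + x\<^sup>2/16) * exp (- 1 * r\<^sup>2))"
  proof (rule AE_I2)
    fix r :: real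
    have "norm (?f r) \<le> exp (32/3 + x\<^sup>2/16) * exp (- 1 * r\<^sup>2)" if "r \<ge> 0"
    proof -
      have "norm (?f r) = exp ((r/2)^3 / 3 - (r/2) * (s * (r * sqrt 3 / 2))\<^sup>2 - (r/2) * x)"
        by (simp only: norm_mult norm_cis mult_1_right airy_ray_point[OF assms] norm_airy_integrand)
      also have "(r/2)^3 / 3 - (r/2) * (s * (r * sqrt 3 / 2))\<^sup>2 - (r/2) * x = - (r^3) / 3 - r * x / 2"
        using assms by (auto simp: power_mult_distrib power_divide power3_eq_cube[of r] power2_eq_square[of r])
      also have "\<dots> \<le> (32/3 + x\<^sup>2/16) - r\<^sup>2"
      proof -
        \<comment> \<open>Expanding to r^3 - 6 r^2 + 32 gives r^3/3 >= 2 r^2 - 32/3. One r^2 is kept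
          for the Gaussian, the other absorbs - r x / 2 through the second square at the cost of
          x^2/16.\<close>
        have "0 \<le> (r - 4)\<^sup>2 * (r + 2)" using that by simp
        moreover have "0 \<le> (r + x / 4)\<^sup>2" by simp
        ultimately show ?thesis
          by (simp add: power2_eq_square power3_eq_cube algebra_simps)
      qed
      finally show ?thesis by (simp flip: exp_add)
    qed
    then show "norm (indicator {0..} r *\<^sub>R ?f r) \<le> norm (exp (32/3 + x\<^sup>2/16) * exp (- 1 * r\<^sup>2))"
      by (simp split: split_indicator)
  qed
qed

lemma integrable_airy_line:
  assumes "c > 0"
  shows "integrable lborel (\<lambda>\<sigma>. airy_integrand x (Complex c \<sigma>))"
proof (rule Bochner_Integration.integrable_bound)
  show "integrable lborel (\<lambda>\<sigma>. exp (c ^ 3 / 3 - c * x) * exp (- c * \<sigma>\<^sup>2))"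
    using assms by (intro integrable_mult_right integrable_gaussian)
  show "(\<lambda>\<sigma>. airy_integrand x (Complex c \<sigma>)) \<in> borel_measurable lborel"
    unfolding Complex_eq by (simp, intro borel_measurable_continuous_onI continuous_intros)
  show "AE \<sigma> in lborel. norm (airy_integrand x (Complex c \<sigma>)) \<le> norm (exp (c ^ 3 / 3 - c * x) * exp (- c * \<sigma>\<^sup>2))"
    by (intro AE_I2) (simp add: norm_airy_integrand flip: exp_add)
qed

text \<open>Cauchy's theorem in the form of a global primitive: both rays and the vertical line
  are evaluated by the same limits of the primitive at infinity.\<close>

lemma Airy_Ai_line:
  assumes "c > 0"
  shows "Airy_Ai x = Re (\<integral>\<sigma>. airy_integrand x (Complex c \<sigma>) \<partial>lborel) / (2 * pi)"
proof -
  have "airy_integrand x holomorphic_on UNIV"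
    using airy_integrand_has_derivative by (intro holomorphic_onI) (auto simp: field_differentiable_def)
  then obtain G where G: "\<And>z. (G has_field_derivative airy_integrand x z) (at z)"
    using holomorphic_convex_primitive'[of UNIV "airy_integrand x"] by auto
  define R where "R s = (LINT r:{0..}|lborel. airy_integrand x (of_real r * cis (s * (pi/3))) * cis (s * (pi/3)))" for s
  have ray: "((\<lambda>r. G (of_real r * cis (s * (pi/3)))) \<longlongrightarrow> G 0 + R s) at_top" if s: "s = 1 \<or> s = -1" for s
  proof -
    have "((\<lambda>b. LINT r:{0..b}|lborel. airy_integrand x (of_real r * cis (s * (pi/3))) * cis (s * (pi/3)))
      \<longlongrightarrow> R s) at_top"
      unfolding R_def by (intro tendsto_set_lebesgue_integral_at_top set_integrable_airy_ray s) simp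
    moreover have "eventually (\<lambda>b. (LINT r:{0..b}|lborel. airy_integrand x (of_real r * cis (s * (pi/3))) * cis (s * (pi/3)))
       = G (of_real b * cis (s * (pi/3))) - G (of_real 0 * cis (s * (pi/3)))) at_top"
      using eventually_ge_at_top[of 0]
    proof eventually_elim
      case (elim b)
      have "((\<lambda>r. G (of_real r * cis (s * (pi/3)))) has_vector_derivative
            airy_integrand x (of_real r * cis (s * (pi/3))) * cis (s * (pi/3))) (at r)" for r
      proof -
        have "((\<lambda>r. of_real r * cis (s * (pi/3))) has_vector_derivative cis (s * (pi/3))) (at r)"
          by (auto intro!: derivative_eq_intros)
        from field_vector_diff_chain_at[OF this G] show ?thesis by (simp add: o_def mult.commute)
      qed
      then show ?case
        unfolding set_lebesgue_integral_def using elim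
        by (intro integral_FTC_Icc continuous_intros) (auto intro: has_vector_derivative_at_within)
    qed
    ultimately have "((\<lambda>b. G (of_real b * cis (s * (pi/3))) - G 0) \<longlongrightarrow> R s) at_top"
      by (simp add: tendsto_cong)
    from tendsto_add[OF tendsto_const[of "G 0"] this] show ?thesis by simp
  qed
  \<comment> \<open>The point of the ray and the point of the vertical line at the same height are
    joined by a horizontal segment, whose length is at most r / 2 and on which the integrand decays
    like a Gaussian in r. So \<open>G\<close> has the same limit along both.\<close>
  have line0: "((\<lambda>r. G (Complex c (s * (r * sqrt 3 / 2)))) \<longlongrightarrow> G 0 + R s) at_top" if s: "s = 1 \<or> s = -1" for s
  proof -
    have "((\<lambda>r. G (of_real r * cis (s * (pi/3))) - G (Complex c (s * (r * sqrt 3 / 2)))) \<longlongrightarrow> 0) at_top"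
    proof (rule Lim_null_comparison)
      show "((\<lambda>r. exp (c * (\<bar>x\<bar> - 2/3 * r\<^sup>2)) * (r / 2)) \<longlongrightarrow> 0) at_top"
        using assms by real_asymp
      have "eventually (\<lambda>r. \<bar>x\<bar> - 2/3 * r\<^sup>2 \<le> 0) at_top"
        by real_asymp
      then show "eventually (\<lambda>r. norm (G (of_real r * cis (s * (pi/3))) - G (Complex c (s * (r * sqrt 3 / 2))))
         \<le> exp (c * (\<bar>x\<bar> - 2/3 * r\<^sup>2)) * (r / 2)) at_top"
        using eventually_ge_at_top[of "2 * c"]
      proof eventually_elim
        case (elim r)
        let ?p = "Complex (r/2) (s * (r * sqrt 3 / 2))" and ?q = "Complex c (s * (r * sqrt 3 / 2))"
        have "norm (G ?p - G ?q) \<le> exp (c * (\<bar>x\<bar> - 2/3 * r\<^sup>2)) * norm (?p - ?q)"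
        proof (rule field_differentiable_bound)
          show "convex (closed_segment ?q ?p)" by simp
          show "?p \<in> closed_segment ?q ?p" "?q \<in> closed_segment ?q ?p" by simp_all
          show "(G has_field_derivative airy_integrand x z) (at z within closed_segment ?q ?p)" for z
            using G by (rule has_field_derivative_at_within)
          show "norm (airy_integrand x z) \<le> exp (c * (\<bar>x\<bar> - 2/3 * r\<^sup>2))" if z: "z \<in> closed_segment ?q ?p" for z
          proof -
            obtain t where t: "0 \<le> t" "t \<le> 1" "z = (1 - t) *\<^sub>R ?q + t *\<^sub>R ?p"
              using z by (auto simp: in_segment)
            define u where "u = (1 - t) * c + t * (r / 2)"
            have zu: "z = Complex u (s * (r * sqrt 3 / 2))"
              using t(3) by (simp add: complex_eq_iff u_def algebra_simps)
            have u: "c \<le> u" "u \<le> r / 2"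
            proof -
              have "0 \<le> t * (r / 2 - c)" "0 \<le> (1 - t) * (r / 2 - c)"
                using t elim by (auto intro!: mult_nonneg_nonneg)
              then show "c \<le> u" "u \<le> r / 2" by (auto simp: u_def field_simps)
            qed
            have "u\<^sup>2 \<le> (r/2)\<^sup>2" using u assms by (intro power_mono) auto
            \<comment> \<open>Here u^2/3 <= r^2/12, and 1/12 - 3/4 = -2/3.\<close>
            then have "u\<^sup>2 / 3 - 3/4 * r\<^sup>2 - x \<le> \<bar>x\<bar> - 2/3 * r\<^sup>2"
              by (auto simp: power_divide)
            then have "u * (u\<^sup>2 / 3 - 3/4 * r\<^sup>2 - x) \<le> u * (\<bar>x\<bar> - 2/3 * r\<^sup>2)"
              using u assms by (intro mult_left_mono) auto
            \<comment> \<open>For large r the bracket is non-positive, so lowering the factor from u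
              to c increases the product.\<close>
            also have "\<dots> \<le> c * (\<bar>x\<bar> - 2/3 * r\<^sup>2)"
              using u elim by (intro mult_right_mono_neg) auto
            finally have "u * (u\<^sup>2 / 3 - 3/4 * r\<^sup>2 - x) \<le> c * (\<bar>x\<bar> - 2/3 * r\<^sup>2)" .
            moreover have "u ^ 3 / 3 - u * (s * (r * sqrt 3 / 2))\<^sup>2 - u * x = u * (u\<^sup>2 / 3 - 3/4 * r\<^sup>2 - x)"
              using s by (auto simp: power_mult_distrib power_divide power3_eq_cube power2_eq_square algebra_simps)
            ultimately show ?thesis by (simp add: zu norm_airy_integrand)
          qed
        qed
        also have "?p - ?q = of_real (r / 2 - c)"
          by (simp add: complex_eq_iff)
        also have "exp (c * (\<bar>x\<bar> - 2/3 * r\<^sup>2)) * norm (of_real (r / 2 - c) :: complex) \<le>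
            exp (c * (\<bar>x\<bar> - 2/3 * r\<^sup>2)) * (r / 2)"
          unfolding norm_of_real using elim assms by (intro mult_left_mono) auto
        finally show ?case by (simp only: airy_ray_point[OF s])
      qed
    qed
    from tendsto_diff[OF ray[OF s] this] show ?thesis by simp
  qed
  have line: "((\<lambda>\<sigma>. G (Complex c (s * \<sigma>))) \<longlongrightarrow> G 0 + R s) at_top" if s: "s = 1 \<or> s = -1" for s
  proof -
    have "filterlim (\<lambda>\<sigma>::real. 2 * \<sigma> / sqrt 3) at_top at_top" by real_asymp
    from filterlim_compose[OF line0[OF s] this] show ?thesis by simp
  qed
  \<comment> \<open>On the line d zeta = i d sigma, so the primitive in sigma is \<open>G\<close>
    divided by i, that is, times - i.\<close>
  have "(\<integral>\<sigma>. airy_integrand x (Complex c \<sigma>) \<partial>lborel) = - \<i> * (G 0 + R 1) - (- \<i> * (G 0 + R (-1)))"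
  proof (rule integral_FTC_real_line)
    show "((\<lambda>\<sigma>. - \<i> * G (Complex c \<sigma>)) has_vector_derivative airy_integrand x (Complex c \<sigma>)) (at \<sigma>)" for \<sigma>
    proof -
      have "((\<lambda>\<sigma>. Complex c \<sigma>) has_vector_derivative \<i>) (at \<sigma>)"
        unfolding Complex_eq by (auto intro!: derivative_eq_intros)
      from has_vector_derivative_mult_right[OF field_vector_diff_chain_at[OF this G], of "- \<i>"]
      show ?thesis by (simp add: o_def)
    qed
    show "continuous_on UNIV (\<lambda>\<sigma>. airy_integrand x (Complex c \<sigma>))"
      unfolding Complex_eq by (intro continuous_intros)
    show "((\<lambda>\<sigma>. - \<i> * G (Complex c \<sigma>)) \<longlongrightarrow> - \<i> * (G 0 + R 1)) at_top"
      using tendsto_mult_left[OF line[of 1], of "- \<i>"] by simp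
    show "((\<lambda>\<sigma>. - \<i> * G (Complex c \<sigma>)) \<longlongrightarrow> (- \<i> * (G 0 + R (-1)))) at_bot"
      unfolding filterlim_at_bot_mirror using tendsto_mult_left[OF line[of "-1"], of "- \<i>"] by simp
  qed (intro integrable_airy_line assms)
  also have "\<dots> = (R 1 - R (-1)) / \<i>" by (simp add: algebra_simps)
  finally have int: "(\<integral>\<sigma>. airy_integrand x (Complex c \<sigma>) \<partial>lborel) = (R 1 - R (-1)) / \<i>" .
  have "Airy_Ai x = Re (1 / (2 * of_real pi * \<i>) * (R 1 - R (-1)))"
    by (simp add: Airy_Ai_def R_def)
  also have "1 / (2 * of_real pi * \<i>) * (R 1 - R (-1)) = (R 1 - R (-1)) / \<i> / of_real (2 * pi)"
    by (simp add: field_simps)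
  finally show ?thesis
    by (simp only: int Re_divide_of_real)
qed

section \<open>Moments of the Airy integrand: decay, derivatives and Airy's equation\<close>

definition airy_moment :: "nat \<Rightarrow> real \<Rightarrow> complex" where
  "airy_moment n t = (\<integral>\<sigma>. Complex 1 \<sigma> ^ n * airy_integrand t (Complex 1 \<sigma>) \<partial>lborel)"

definition Airy_Ai' :: "real \<Rightarrow> real" where
  "Airy_Ai' t = - Re (airy_moment 1 t) / (2 * pi)"

lemma norm_airy_moment_integrand:
  assumes "n \<le> 2"
  shows "norm (Complex 1 \<sigma> ^ n * airy_integrand t (Complex 1 \<sigma>)) \<le> 2 * exp (1/3 - t) * exp (- (1/2) * \<sigma>\<^sup>2)"
proof -
  have "norm (Complex 1 \<sigma>) ^ n \<le> norm (Complex 1 \<sigma>) ^ 2"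
    using assms by (intro power_increasing) (auto simp: complex_norm)
  also have "\<dots> = 1 + \<sigma>\<^sup>2" by (simp add: complex_norm)
  \<comment> \<open>Half of the available Gaussian is spent on absorbing the polynomial
    factor.\<close>
  also have "\<dots> \<le> 2 * exp (\<sigma>\<^sup>2 / 2)"
    using exp_ge_add_one_self[of "\<sigma>\<^sup>2 / 2"] by argo
  finally have "norm (Complex 1 \<sigma> ^ n * airy_integrand t (Complex 1 \<sigma>))
      \<le> 2 * exp (\<sigma>\<^sup>2 / 2) * exp (1 / 3 - \<sigma>\<^sup>2 - t)"
    by (simp add: norm_mult norm_power norm_airy_integrand)
  then show ?thesis by (simp add: field_simps flip: exp_add)
qed

lemma integrable_airy_moment:
  assumes "n \<le> 2"
  shows "integrable lborel (\<lambda>\<sigma>. Complex 1 \<sigma> ^ n * airy_integrand t (Complex 1 \<sigma>))"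
proof (rule Bochner_Integration.integrable_bound)
  show "integrable lborel (\<lambda>\<sigma>. 2 * exp (1/3 - t) * exp (- (1/2) * \<sigma>\<^sup>2))"
    by (intro integrable_mult_right integrable_gaussian) simp
  show "(\<lambda>\<sigma>. Complex 1 \<sigma> ^ n * airy_integrand t (Complex 1 \<sigma>)) \<in> borel_measurable lborel"
    unfolding Complex_eq by (simp, intro borel_measurable_continuous_onI continuous_intros)
  show "AE \<sigma> in lborel. norm (Complex 1 \<sigma> ^ n * airy_integrand t (Complex 1 \<sigma>))
      \<le> norm (2 * exp (1/3 - t) * exp (- (1/2) * \<sigma>\<^sup>2))"
    using norm_airy_moment_integrand[OF assms] by simp
qed

text \<open>The line Re zeta = 1 contributes exactly the factor exp (- t), for t of either sign; the
  rest of the bound is a fixed Gaussian integral.\<close>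

lemma norm_airy_moment:
  assumes "n \<le> 2"
  shows "norm (airy_moment n t) \<le> 2 * exp (1/3) * sqrt (2 * pi) * exp (- t)"
proof -
  have "norm (airy_moment n t) \<le> (\<integral>\<sigma>. 2 * exp (1/3 - t) * exp (- (1/2) * \<sigma>\<^sup>2) \<partial>lborel)"
    unfolding airy_moment_def
    by (intro Bochner_Integration.integral_norm_bound_integral integrable_airy_moment norm_airy_moment_integrand assms
        integrable_mult_right integrable_gaussian) simp
  also have "\<dots> = 2 * exp (1/3 - t) * sqrt (2 * pi)"
    using integral_gaussian[of "1/2"] by (simp only: integral_mult_right_zero) (simp add: mult.commute)
  also have "exp (1/3 - t) = exp (1/3) * exp (- t)" by (simp flip: exp_add)
  finally show ?thesis by (simp add: mult_ac)
qed

text \<open>Differentiation in \<open>t\<close> brings down a factor - zeta. The dominating function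
  must serve all parameters within distance 1 of \<open>t\<close>, whence the extra 1 in its
  exponent.\<close>

lemma airy_moment_has_derivative:
  assumes "n \<le> 1"
  shows "(airy_moment n has_vector_derivative - airy_moment (Suc n) t) (at t)"
proof -
  have "((\<lambda>t. \<integral>\<sigma>. Complex 1 \<sigma> ^ n * airy_integrand t (Complex 1 \<sigma>) \<partial>lborel) has_vector_derivative
     (\<integral>\<sigma>. - (Complex 1 \<sigma> ^ Suc n * airy_integrand t (Complex 1 \<sigma>)) \<partial>lborel)) (at t)"
  proof (rule has_vector_derivative_lebesgue_integral[where d = 1 and
        g = "\<lambda>\<sigma>. 2 * exp (1/3 + 1 - t) * exp (- (1/2) * \<sigma>\<^sup>2)"])
    show "((\<lambda>y. Complex 1 \<sigma> ^ n * airy_integrand y (Complex 1 \<sigma>)) has_vector_derivative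
           - (Complex 1 \<sigma> ^ Suc n * airy_integrand y (Complex 1 \<sigma>))) (at y)" for y \<sigma>
    proof -
      have "((\<lambda>w. Complex 1 \<sigma> ^ n * exp (Complex 1 \<sigma> ^ 3 / 3 - Complex 1 \<sigma> * w)) has_field_derivative
          - (Complex 1 \<sigma> ^ Suc n * exp (Complex 1 \<sigma> ^ 3 / 3 - Complex 1 \<sigma> * of_real y))) (at (of_real y))"
        by (auto intro!: derivative_eq_intros)
      from has_vector_derivative_real_field[OF this] show ?thesis
        by (simp add: airy_integrand_def)
    qed
    show "integrable lborel (\<lambda>\<sigma>. Complex 1 \<sigma> ^ n * airy_integrand y (Complex 1 \<sigma>))" for y
      using assms by (intro integrable_airy_moment) simp
    show "(\<lambda>\<sigma>. - (Complex 1 \<sigma> ^ Suc n * airy_integrand t (Complex 1 \<sigma>))) \<in> borel_measurable lborel"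
      using assms by (intro borel_measurable_uminus borel_measurable_integrable integrable_airy_moment) simp
    show "norm (- (Complex 1 \<sigma> ^ Suc n * airy_integrand y (Complex 1 \<sigma>)))
        \<le> 2 * exp (1/3 + 1 - t) * exp (- (1/2) * \<sigma>\<^sup>2)" if "dist y t < 1" for y \<sigma>
    proof -
      have "norm (- (Complex 1 \<sigma> ^ Suc n * airy_integrand y (Complex 1 \<sigma>)))
        \<le> 2 * exp (1/3 - y) * exp (- (1/2) * \<sigma>\<^sup>2)"
        unfolding norm_minus_cancel using assms by (intro norm_airy_moment_integrand) simp
      also have "\<dots> \<le> 2 * exp (1/3 + 1 - t) * exp (- (1/2) * \<sigma>\<^sup>2)"
        using that by (intro mult_right_mono) (auto simp: dist_real_def)
      finally show ?thesis .
    qed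
    show "integrable lborel (\<lambda>\<sigma>. 2 * exp (1/3 + 1 - t) * exp (- (1/2) * \<sigma>\<^sup>2))"
      by (intro integrable_mult_right integrable_gaussian) simp
  qed simp
  then show ?thesis
    by (simp only: airy_moment_def[abs_def] integral_minus)
qed

text \<open>The integrand of the difference is (zeta^2 - t) exp (zeta^3/3 - zeta t), a derivative in
  zeta, so it integrates to end values, which vanish. This is Airy's equation in terms of
  moments.\<close>

lemma airy_moment_2: "airy_moment 2 t = of_real t * airy_moment 0 t"
proof -
  let ?g = "\<lambda>\<sigma>. Complex 1 \<sigma> ^ 2 * airy_integrand t (Complex 1 \<sigma>) -
      of_real t * (Complex 1 \<sigma> ^ 0 * airy_integrand t (Complex 1 \<sigma>))"
  have int: "integrable lborel (\<lambda>\<sigma>. Complex 1 \<sigma> ^ 2 * airy_integrand t (Complex 1 \<sigma>))"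
    "integrable lborel (\<lambda>\<sigma>. of_real t * (Complex 1 \<sigma> ^ 0 * airy_integrand t (Complex 1 \<sigma>)))"
    by (auto intro: integrable_airy_moment simp del: power_0)
  have lim: "((\<lambda>\<sigma>. - \<i> * airy_integrand t (Complex 1 \<sigma>)) \<longlongrightarrow> 0) F" if "F = at_bot \<or> F = at_top" for F
  proof (rule Lim_null_comparison)
    show "eventually (\<lambda>\<sigma>. norm (- \<i> * airy_integrand t (Complex 1 \<sigma>)) \<le> exp (1/3 - t - \<sigma>\<^sup>2)) F"
      unfolding norm_mult norm_airy_integrand by (simp add: algebra_simps)
    show "((\<lambda>\<sigma>::real. exp (1/3 - t - \<sigma>\<^sup>2)) \<longlongrightarrow> 0) F"
      using that by (elim disjE; simp only:; real_asymp)
  qed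
  have "(\<integral>\<sigma>. ?g \<sigma> \<partial>lborel) = 0 - 0"
  proof (rule integral_FTC_real_line)
    show "((\<lambda>\<sigma>. - \<i> * airy_integrand t (Complex 1 \<sigma>)) has_vector_derivative ?g \<sigma>) (at \<sigma>)" for \<sigma>
    proof -
      have "((\<lambda>\<sigma>. Complex 1 \<sigma>) has_vector_derivative \<i>) (at \<sigma>)"
        unfolding Complex_eq by (auto intro!: derivative_eq_intros)
      from has_vector_derivative_mult_right[OF field_vector_diff_chain_at[OF this airy_integrand_has_derivative], of "- \<i>"]
      show ?thesis by (simp add: o_def algebra_simps)
    qed
    show "continuous_on UNIV ?g"
      unfolding Complex_eq by (intro continuous_intros)
  qed (use int lim in auto)
  then show ?thesis
    using int by (simp add: airy_moment_def)
qed

lemma Airy_Ai_eq_moment: "Airy_Ai t = Re (airy_moment 0 t) / (2 * pi)"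
  by (simp add: Airy_Ai_line[of 1] airy_moment_def)

lemma Airy_Ai_has_derivative: "(Airy_Ai has_real_derivative Airy_Ai' t) (at t)"
  unfolding Airy_Ai_eq_moment[abs_def] Airy_Ai'_def has_real_derivative_iff_has_vector_derivative
  using has_vector_derivative_divide[OF bounded_linear.has_vector_derivative[OF bounded_linear_Re
        airy_moment_has_derivative[of 0 t]], of "2 * pi"] by simp

lemma Airy_Ai'_has_derivative: "(Airy_Ai' has_real_derivative t * Airy_Ai t) (at t)"
  unfolding Airy_Ai_eq_moment[abs_def] Airy_Ai'_def[abs_def] has_real_derivative_iff_has_vector_derivative
  using has_vector_derivative_divide[OF has_vector_derivative_minus[OF
        bounded_linear.has_vector_derivative[OF bounded_linear_Re airy_moment_has_derivative[of 1 t]]], of "2 * pi"]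
  by (simp add: airy_moment_2 numeral_2_eq_2[symmetric])

lemma Airy_Ai_exp_bound:
  obtains C where "C \<ge> 0" "\<And>t. \<bar>Airy_Ai t\<bar> \<le> C * exp (- t)" "\<And>t. \<bar>Airy_Ai' t\<bar> \<le> C * exp (- t)"
proof (rule that)
  let ?C = "2 * exp (1/3) * sqrt (2 * pi) / (2 * pi)"
  have *: "\<bar>Re (airy_moment n t)\<bar> / (2 * pi) \<le> ?C * exp (- t)" if "n \<le> 2" for n t
    using order_trans[OF abs_Re_le_cmod norm_airy_moment[OF that, of t]]
    by (simp add: divide_simps mult_ac)
  show "\<bar>Airy_Ai t\<bar> \<le> ?C * exp (- t)" for t
    using *[of 0 t] by (simp add: Airy_Ai_eq_moment)
  show "\<bar>Airy_Ai' t\<bar> \<le> ?C * exp (- t)" for t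
    using *[of 1 t] by (simp add: Airy_Ai'_def)
qed simp

text \<open>The line \<open>Re \<zeta> = b y\<close>, with its parameter rescaled by \<open>sqrt y\<close>. For \<open>c\<^sup>2 = t\<close> this is the
  steepest descent line; keeping \<open>c\<close> free makes the exponential prefactor exactly that of the eigenfunctions.\<close>

lemma Airy_Ai_scaled:
  assumes "b > 0" "y > 0"
  defines "c \<equiv> b * y"
  shows "Airy_Ai t = exp (c ^ 3 / 3 - c * t) / (2 * pi * sqrt y) *
    (\<integral>\<tau>. exp (- b * \<tau>\<^sup>2) * cos (\<tau> * (c\<^sup>2 - t) / sqrt y - \<tau> ^ 3 / (3 * y * sqrt y)) \<partial>lborel)"
proof -
  have c: "c > 0" using assms by simp
  have Re: "Re (airy_integrand t (Complex c \<sigma>)) =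
      exp (c ^ 3 / 3 - c * t) * (exp (- c * \<sigma>\<^sup>2) * cos (\<sigma> * (c\<^sup>2 - t) - \<sigma> ^ 3 / 3))" for \<sigma>
    by (simp add: airy_integrand_def Re_exp power3_eq_cube power2_eq_square mult.assoc[symmetric] flip: exp_add)
       (simp add: field_simps)
  have "Re (\<integral>\<sigma>. airy_integrand t (Complex c \<sigma>) \<partial>lborel) =
      exp (c ^ 3 / 3 - c * t) * (\<integral>\<sigma>. exp (- c * \<sigma>\<^sup>2) * cos (\<sigma> * (c\<^sup>2 - t) - \<sigma> ^ 3 / 3) \<partial>lborel)"
    using integral_Re[OF integrable_airy_line[OF c, of t]] by (simp only: Re integral_mult_right_zero)
  also have "(\<integral>\<sigma>. exp (- c * \<sigma>\<^sup>2) * cos (\<sigma> * (c\<^sup>2 - t) - \<sigma> ^ 3 / 3) \<partial>lborel) =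
      \<bar>1 / sqrt y\<bar> *\<^sub>R (\<integral>\<tau>. exp (- c * (0 + 1 / sqrt y * \<tau>)\<^sup>2) *
        cos ((0 + 1 / sqrt y * \<tau>) * (c\<^sup>2 - t) - (0 + 1 / sqrt y * \<tau>) ^ 3 / 3) \<partial>lborel)"
    using assms by (intro lborel_integral_real_affine) simp
  also have "(\<lambda>\<tau>. exp (- c * (0 + 1 / sqrt y * \<tau>)\<^sup>2) *
        cos ((0 + 1 / sqrt y * \<tau>) * (c\<^sup>2 - t) - (0 + 1 / sqrt y * \<tau>) ^ 3 / 3)) =
     (\<lambda>\<tau>. exp (- b * \<tau>\<^sup>2) * cos (\<tau> * (c\<^sup>2 - t) / sqrt y - \<tau> ^ 3 / (3 * y * sqrt y)))"
    using assms by (intro ext) (simp add: c_def power_divide power3_eq_cube[of "sqrt _"] ac_simps)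
  finally show ?thesis
    using assms(2) by (simp add: Airy_Ai_line[OF c] field_simps)
qed

text \<open>The cosine is bounded by 1, so the Gaussian itself dominates and pointwise convergence
  of the phase is enough. This serves both the sign of Ai near infinity and the scaling limit of the
  kernel.\<close>

lemma tendsto_gaussian_cos_integral:
  assumes "b > 0"
    and cont: "\<And>y. continuous_on UNIV (\<phi> y)"
    and lim: "\<And>\<tau>. ((\<lambda>y. \<phi> y \<tau>) \<longlongrightarrow> 0) at_top"
  shows "((\<lambda>y::real. \<integral>\<tau>. exp (- b * \<tau>\<^sup>2) * cos (\<phi> y \<tau>) \<partial>lborel) \<longlongrightarrow> sqrt (pi / b)) at_top"
  unfolding integral_gaussian[OF assms(1), symmetric]
proof (rule integral_dominated_convergence_at_top)
  show "integrable lborel (\<lambda>\<tau>. exp (- b * \<tau>\<^sup>2))"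
    using assms(1) by (rule integrable_gaussian)
  show "(\<lambda>\<tau>. exp (- b * \<tau>\<^sup>2) * cos (\<phi> y \<tau>)) \<in> borel_measurable lborel" for y
    by (simp, intro borel_measurable_continuous_onI continuous_intros cont)
  show "AE \<tau> in lborel. ((\<lambda>y. exp (- b * \<tau>\<^sup>2) * cos (\<phi> y \<tau>)) \<longlongrightarrow> exp (- b * \<tau>\<^sup>2)) at_top"
    using tendsto_mult[OF tendsto_const tendsto_cos[OF lim]] by auto
  show "eventually (\<lambda>y. AE \<tau> in lborel. norm (exp (- b * \<tau>\<^sup>2) * cos (\<phi> y \<tau>)) \<le> exp (- b * \<tau>\<^sup>2)) at_top"
    by (auto simp: abs_mult mult_left_le)
qed simp

lemma abs_gaussian_cos_integral_le:
  assumes "b > 0" "continuous_on UNIV \<phi>"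
  shows "\<bar>\<integral>\<tau>. exp (- b * \<tau>\<^sup>2) * cos (\<phi> \<tau>) \<partial>lborel\<bar> \<le> sqrt (pi / b)"
proof -
  have "norm (\<integral>\<tau>. exp (- b * \<tau>\<^sup>2) * cos (\<phi> \<tau>) \<partial>lborel) \<le> (\<integral>\<tau>. exp (- b * \<tau>\<^sup>2) \<partial>lborel)"
  proof (rule Bochner_Integration.integral_norm_bound_integral)
    show "integrable lborel (\<lambda>\<tau>. exp (- b * \<tau>\<^sup>2) * cos (\<phi> \<tau>))"
    proof (rule Bochner_Integration.integrable_bound[OF integrable_gaussian[OF assms(1)]])
      show "(\<lambda>\<tau>. exp (- b * \<tau>\<^sup>2) * cos (\<phi> \<tau>)) \<in> borel_measurable lborel"
        by (simp, intro borel_measurable_continuous_onI continuous_intros assms)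
    qed (auto simp: abs_mult mult_left_le)
  qed (auto simp: abs_mult mult_left_le intro: integrable_gaussian[OF assms(1), simplified])
  then show ?thesis by (simp only: integral_gaussian[OF assms(1)] real_norm_def)
qed

text \<open>With b = 1 and y = sqrt t the line is the steepest descent line c^2 = t: the linear
  phase disappears and the cubic one tends to 0, so the remaining integral tends to sqrt pi >
  0.\<close>

lemma eventually_Airy_Ai_pos: "eventually (\<lambda>t. Airy_Ai t > 0) at_top"
proof -
  let ?I = "\<lambda>y. \<integral>\<tau>. exp (- 1 * \<tau>\<^sup>2) * cos (- (\<tau> ^ 3) / (3 * y * sqrt y)) \<partial>lborel"
  have "(?I \<longlongrightarrow> sqrt (pi / 1)) at_top"
  proof (rule tendsto_gaussian_cos_integral)
    show "continuous_on UNIV (\<lambda>\<tau>. - (\<tau> ^ 3) / (3 * y * sqrt y))" for y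
      unfolding divide_inverse by (intro continuous_intros)
    show "((\<lambda>y. - (\<tau> ^ 3) / (3 * y * sqrt y)) \<longlongrightarrow> 0) at_top" for \<tau> :: real
      by real_asymp
  qed simp
  then have "((\<lambda>t. ?I (sqrt t)) \<longlongrightarrow> sqrt (pi / 1)) at_top"
    using filterlim_compose sqrt_at_top by blast
  then have "eventually (\<lambda>t. ?I (sqrt t) > 0) at_top"
    by (rule order_tendstoD) simp
  then show ?thesis
    using eventually_gt_at_top[of 0]
  proof eventually_elim
    case (elim t)
    then show ?case
      using Airy_Ai_scaled[of 1 "sqrt t" t] by simp
  qed
qed

lemma Airy_Ai_continuous: "continuous_on S Airy_Ai"
  using Airy_Ai_has_derivative by (meson DERIV_isCont continuous_at_imp_continuous_on)

text \<open>Existence of a zero is not needed: without one, \<open>airy_a1\<close> is an arbitrary real, but then the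
  intermediate value theorem already gives positivity everywhere.\<close>

lemma Airy_Ai_pos:
  assumes "t > airy_a1"
  shows "Airy_Ai t > 0"
proof (rule ccontr)
  assume neg: "\<not> Airy_Ai t > 0"
  let ?Z = "{s. Airy_Ai s = 0}"
  obtain B where B: "\<And>s. s \<ge> B \<Longrightarrow> Airy_Ai s > 0"
    using eventually_Airy_Ai_pos by (auto simp: eventually_at_top_linorder)
  have tB: "t \<le> B" using neg B[of t] by linarith
  obtain s where s: "t \<le> s" "Airy_Ai s = 0"
    using IVT'[of Airy_Ai t 0 B] neg B[of B] tB Airy_Ai_continuous by force
  have bdd: "bdd_above ?Z"
    using B by (intro bdd_aboveI[of _ B]) (metis less_irrefl linear mem_Collect_eq)
  have "closed ?Z"
    using continuous_closed_preimage_constant[of UNIV Airy_Ai 0] Airy_Ai_continuous by simp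
  then have "Sup ?Z \<in> ?Z"
    using s(2) bdd by (intro closed_contains_Sup) auto
  moreover have le: "r \<le> Sup ?Z" if "Airy_Ai r = 0" for r
    using bdd that by (intro cSup_upper) auto
  \<comment> \<open>The zero set is closed, bounded above and contains \<open>s\<close>, so its
    supremum is attained and is the greatest zero that \<open>GREATEST\<close> describes.\<close>
  ultimately have "airy_a1 = Sup ?Z"
    unfolding airy_a1_def by (intro Greatest_equality) auto
  then show False using le[OF s(2)] s(1) assms by linarith
qed

subsection \<open>Growth classes\<close>

text \<open>The class of admissible weights: it is closed under sums and products, contains
  polynomials and exp (c y z), and later also \<open>\<psi>\<close> and its derivative. The
  constants are uniform for y in a bounded interval because the integrals are to be differentiated
  in y.\<close>

definition exp_bounded :: "real \<Rightarrow> (real \<Rightarrow> real \<Rightarrow> real) \<Rightarrow> bool" where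
  "exp_bounded Y g \<longleftrightarrow>
    (\<exists>C m. 0 \<le> C \<and> 0 \<le> m \<and> (\<forall>y z. \<bar>y\<bar> \<le> Y \<longrightarrow> \<bar>g y z\<bar> \<le> C * exp (m * \<bar>z\<bar>)))"

lemma exp_boundedI:
  assumes "0 \<le> C" "0 \<le> m" "\<And>y z. \<bar>y\<bar> \<le> Y \<Longrightarrow> \<bar>g y z\<bar> \<le> C * exp (m * \<bar>z\<bar>)"
  shows "exp_bounded Y g"
  using assms unfolding exp_bounded_def by blast

lemma exp_boundedE:
  assumes "exp_bounded Y g"
  obtains C m where "0 \<le> C" "0 \<le> m" "\<And>y z. \<bar>y\<bar> \<le> Y \<Longrightarrow> \<bar>g y z\<bar> \<le> C * exp (m * \<bar>z\<bar>)"
  using assms unfolding exp_bounded_def by blast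

named_theorems exp_bounded_intros

lemma exp_bounded_const [exp_bounded_intros]: "exp_bounded Y (\<lambda>y z. c)"
  by (rule exp_boundedI[of "\<bar>c\<bar>" 0]) auto

lemma exp_bounded_fst [exp_bounded_intros]: "exp_bounded Y (\<lambda>y z. y)"
  by (rule exp_boundedI[of "\<bar>Y\<bar>" 0]) auto

lemma exp_bounded_snd [exp_bounded_intros]: "exp_bounded Y (\<lambda>y z. z)"
proof (rule exp_boundedI[of 1 1])
  show "\<bar>z\<bar> \<le> 1 * exp (1 * \<bar>z\<bar>)" for z :: real
    using exp_ge_add_one_self[of "\<bar>z\<bar>"] by argo
qed auto

lemma exp_bounded_add [exp_bounded_intros]:
  assumes "exp_bounded Y f" "exp_bounded Y g"
  shows "exp_bounded Y (\<lambda>y z. f y z + g y z)"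
proof -
  obtain C m where f: "0 \<le> C" "0 \<le> m" "\<And>y z. \<bar>y\<bar> \<le> Y \<Longrightarrow> \<bar>f y z\<bar> \<le> C * exp (m * \<bar>z\<bar>)"
    using assms(1) by (rule exp_boundedE) blast
  obtain D n where g: "0 \<le> D" "0 \<le> n" "\<And>y z. \<bar>y\<bar> \<le> Y \<Longrightarrow> \<bar>g y z\<bar> \<le> D * exp (n * \<bar>z\<bar>)"
    using assms(2) by (rule exp_boundedE) blast
  show ?thesis
  proof (rule exp_boundedI[of "C + D" "m + n"])
    fix y z :: real assume y: "\<bar>y\<bar> \<le> Y"
    have "\<bar>f y z + g y z\<bar> \<le> C * exp (m * \<bar>z\<bar>) + D * exp (n * \<bar>z\<bar>)"
      using f(3)[OF y, of z] g(3)[OF y, of z] by linarith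
    also have "\<dots> \<le> C * exp ((m + n) * \<bar>z\<bar>) + D * exp ((m + n) * \<bar>z\<bar>)"
      using f g by (intro add_mono mult_left_mono) (auto intro!: mult_right_mono)
    finally show "\<bar>f y z + g y z\<bar> \<le> (C + D) * exp ((m + n) * \<bar>z\<bar>)" by (simp add: algebra_simps)
  qed (use f g in auto)
qed

lemma exp_bounded_mult [exp_bounded_intros]:
  assumes "exp_bounded Y f" "exp_bounded Y g"
  shows "exp_bounded Y (\<lambda>y z. f y z * g y z)"
proof -
  obtain C m where f: "0 \<le> C" "0 \<le> m" "\<And>y z. \<bar>y\<bar> \<le> Y \<Longrightarrow> \<bar>f y z\<bar> \<le> C * exp (m * \<bar>z\<bar>)"
    using assms(1) by (rule exp_boundedE) blast
  obtain D n where g: "0 \<le> D" "0 \<le> n" "\<And>y z. \<bar>y\<bar> \<le> Y \<Longrightarrow> \<bar>g y z\<bar> \<le> D * exp (n * \<bar>z\<bar>)"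
    using assms(2) by (rule exp_boundedE) blast
  show ?thesis
  proof (rule exp_boundedI[of "C * D" "m + n"])
    fix y z :: real assume y: "\<bar>y\<bar> \<le> Y"
    have "\<bar>f y z * g y z\<bar> \<le> (C * exp (m * \<bar>z\<bar>)) * (D * exp (n * \<bar>z\<bar>))"
      unfolding abs_mult using f g y by (intro mult_mono) auto
    then show "\<bar>f y z * g y z\<bar> \<le> C * D * exp ((m + n) * \<bar>z\<bar>)"
      by (simp add: algebra_simps exp_add)
  qed (use f g in auto)
qed

lemma exp_bounded_power [exp_bounded_intros]:
  "exp_bounded Y f \<Longrightarrow> exp_bounded Y (\<lambda>y z. f y z ^ n)"
  by (induction n) (auto intro: exp_bounded_intros)

lemma exp_bounded_diff [exp_bounded_intros]:
  "exp_bounded Y f \<Longrightarrow> exp_bounded Y g \<Longrightarrow> exp_bounded Y (\<lambda>y z. f y z - g y z)"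
  using exp_bounded_add[OF _ exp_bounded_mult[OF exp_bounded_const[of Y "-1"]], of f g] by simp

lemma exp_bounded_exp [exp_bounded_intros]: "exp_bounded Y (\<lambda>y z. exp (c * y * z))"
proof (rule exp_boundedI[of 1 "\<bar>c\<bar> * \<bar>Y\<bar>"])
  fix y z :: real assume y: "\<bar>y\<bar> \<le> Y"
  have "c * y * z \<le> \<bar>c\<bar> * \<bar>y\<bar> * \<bar>z\<bar>"
    by (simp flip: abs_mult)
  also have "\<dots> \<le> \<bar>c\<bar> * \<bar>Y\<bar> * \<bar>z\<bar>"
    using y by (intro mult_right_mono mult_left_mono) auto
  finally show "\<bar>exp (c * y * z)\<bar> \<le> 1 * exp (\<bar>c\<bar> * \<bar>Y\<bar> * \<bar>z\<bar>)" by simp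
qed auto

text \<open>Ai supplies decay at rate b^2; the rate b^2/2 retained here leaves the other half to
  swallow an exponential weight.\<close>

definition gauss_bounded :: "real \<Rightarrow> real \<Rightarrow> (real \<Rightarrow> real \<Rightarrow> real) \<Rightarrow> bool" where
  "gauss_bounded b Y g \<longleftrightarrow> (\<exists>C. \<forall>y z. \<bar>y\<bar> \<le> Y \<longrightarrow> \<bar>g y z\<bar> \<le> C * exp (- (b\<^sup>2 / 2) * z\<^sup>2))"

lemma exp_bounded_imp_gauss_bounded:
  assumes b: "b > 0" and g: "exp_bounded Y (\<lambda>y z. exp (b\<^sup>2 * z\<^sup>2) * g y z)"
  shows "gauss_bounded b Y g"
proof -
  obtain C m where f: "0 \<le> C" "0 \<le> m"
    "\<And>y z. \<bar>y\<bar> \<le> Y \<Longrightarrow> \<bar>exp (b\<^sup>2 * z\<^sup>2) * g y z\<bar> \<le> C * exp (m * \<bar>z\<bar>)"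
    using g by (rule exp_boundedE) blast
  have "\<bar>g y z\<bar> \<le> C * exp (m\<^sup>2 / (2 * b\<^sup>2)) * exp (- (b\<^sup>2 / 2) * z\<^sup>2)" if y: "\<bar>y\<bar> \<le> Y" for y z
  proof -
    \<comment> \<open>This square is chosen so that its cross term is m |z|; the constant left over
      becomes the factor exp (m^2 / (2 b^2)).\<close>
    have "0 \<le> (b * \<bar>z\<bar> - m / b)\<^sup>2 / 2" by simp
    also have "\<dots> = b\<^sup>2 * z\<^sup>2 / 2 - m * \<bar>z\<bar> + m\<^sup>2 / (2 * b\<^sup>2)"
      using b by (simp add: power2_diff power_mult_distrib power_divide field_simps power2_eq_square[of b])
    finally have le: "m * \<bar>z\<bar> - b\<^sup>2 * z\<^sup>2 \<le> m\<^sup>2 / (2 * b\<^sup>2) - (b\<^sup>2 / 2) * z\<^sup>2" by simp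
    have "\<bar>g y z\<bar> = exp (- (b\<^sup>2 * z\<^sup>2)) * \<bar>exp (b\<^sup>2 * z\<^sup>2) * g y z\<bar>"
      by (simp add: abs_mult flip: mult.assoc exp_add)
    also have "\<dots> \<le> exp (- (b\<^sup>2 * z\<^sup>2)) * (C * exp (m * \<bar>z\<bar>))"
      using f(3)[OF y] by (intro mult_left_mono) auto
    also have "\<dots> = C * exp (m * \<bar>z\<bar> - b\<^sup>2 * z\<^sup>2)"
      by (simp add: exp_diff exp_minus field_simps)
    also have "\<dots> \<le> C * exp (m\<^sup>2 / (2 * b\<^sup>2) - (b\<^sup>2 / 2) * z\<^sup>2)"
      using f(1) le by (intro mult_left_mono) auto
    also have "\<dots> = C * exp (m\<^sup>2 / (2 * b\<^sup>2)) * exp (- (b\<^sup>2 / 2) * z\<^sup>2)"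
      by (simp flip: exp_add)
    finally show ?thesis .
  qed
  then show ?thesis unfolding gauss_bounded_def by blast
qed

lemma gauss_bounded_integrable:
  assumes b: "b > 0" and g: "gauss_bounded b Y g" and y: "\<bar>y\<bar> \<le> Y" and cont: "continuous_on UNIV (g y)"
  shows "integrable lborel (g y)"
proof -
  obtain C where C: "\<And>z. \<bar>g y z\<bar> \<le> C * exp (- (b\<^sup>2 / 2) * z\<^sup>2)"
    using g y unfolding gauss_bounded_def by blast
  show ?thesis
  proof (rule Bochner_Integration.integrable_bound)
    show "integrable lborel (\<lambda>z. C * exp (- (b\<^sup>2 / 2) * z\<^sup>2))"
      using b by (intro integrable_mult_right integrable_gaussian) simp
    show "g y \<in> borel_measurable lborel"
      using cont by (simp add: borel_measurable_continuous_onI)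
    show "AE z in lborel. norm (g y z) \<le> norm (C * exp (- (b\<^sup>2 / 2) * z\<^sup>2))"
      using C by (intro AE_I2) (metis abs_ge_self order_trans real_norm_def)
  qed
qed

lemma gauss_bounded_tendsto_0:
  assumes b: "b > 0" and g: "gauss_bounded b Y g" and y: "\<bar>y\<bar> \<le> Y" and F: "F = at_top \<or> F = at_bot"
  shows "(g y \<longlongrightarrow> 0) F"
proof -
  obtain C where C: "\<And>z. \<bar>g y z\<bar> \<le> C * exp (- (b\<^sup>2 / 2) * z\<^sup>2)"
    using g y unfolding gauss_bounded_def by blast
  show ?thesis
  proof (rule Lim_null_comparison)
    show "eventually (\<lambda>z. norm (g y z) \<le> C * exp (- (b\<^sup>2 / 2) * z\<^sup>2)) F"
      using C by simp
    have "((\<lambda>z. exp (- (b\<^sup>2 / 2) * z\<^sup>2)) \<longlongrightarrow> 0) F"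
      using F b by (elim disjE; simp only:; real_asymp)
    then show "((\<lambda>z. C * exp (- (b\<^sup>2 / 2) * z\<^sup>2)) \<longlongrightarrow> 0) F"
      by (rule tendsto_mult_right_zero)
  qed
qed

lemma has_real_derivative_integral_gauss_bounded:
  assumes b: "b > 0"
    and f: "\<And>Y. gauss_bounded b Y f" "\<And>y. continuous_on UNIV (f y)"
    and f': "\<And>Y. gauss_bounded b Y f'" "\<And>y. continuous_on UNIV (f' y)"
    and deriv: "\<And>y z. ((\<lambda>y. f y z) has_real_derivative f' y z) (at y)"
  shows "((\<lambda>y. \<integral>z. f y z \<partial>lborel) has_real_derivative (\<integral>z. f' y z \<partial>lborel)) (at y)"
proof -
  \<comment> \<open>The interval |w| <= |y| + 1 contains the unit ball around y on which domination
    is required.\<close>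
  obtain C where C: "\<And>w z. \<bar>w\<bar> \<le> \<bar>y\<bar> + 1 \<Longrightarrow> \<bar>f' w z\<bar> \<le> C * exp (- (b\<^sup>2 / 2) * z\<^sup>2)"
    using f'(1)[of "\<bar>y\<bar> + 1"] unfolding gauss_bounded_def by blast
  show ?thesis
    unfolding has_real_derivative_iff_has_vector_derivative
  proof (rule has_vector_derivative_lebesgue_integral[where d = 1 and g = "\<lambda>z. C * exp (- (b\<^sup>2 / 2) * z\<^sup>2)"])
    show "((\<lambda>y. f y z) has_vector_derivative f' w z) (at w)" for w z
      using deriv by (simp add: has_real_derivative_iff_has_vector_derivative)
    show "integrable lborel (f w)" for w
      using gauss_bounded_integrable[OF b f(1) order_refl f(2)] .
    show "f' y \<in> borel_measurable lborel"
      using f'(2) by (simp add: borel_measurable_continuous_onI)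
    show "norm (f' w z) \<le> C * exp (- (b\<^sup>2 / 2) * z\<^sup>2)" if "dist w y < 1" for w z
      using C[of w z] that by (auto simp: dist_real_def)
    show "integrable lborel (\<lambda>z. C * exp (- (b\<^sup>2 / 2) * z\<^sup>2))"
      using b by (intro integrable_mult_right integrable_gaussian) simp
  qed simp
qed

text \<open>An energy argument: u^2 + u'^2 has derivative 2 (1 + p) u u', at most (1 + M) (u^2 +
  u'^2) in absolute value when |p| <= M. Weighted by exp ((1 + M) r) the energy is non-decreasing,
  so its vanishing at \<open>t\<close> forces it to vanish to the left.\<close>

lemma linear_ode_zero_left:
  fixes u u' p :: "real \<Rightarrow> real"
  assumes u: "\<And>s. (u has_real_derivative u' s) (at s)" "\<And>s. (u' has_real_derivative p s * u s) (at s)"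
    and p: "continuous_on UNIV p" and zero: "u t = 0" "u' t = 0" and s: "s \<le> t"
  shows "u s = 0"
proof -
  have "compact (p ` {s..t})"
    using p by (intro compact_continuous_image) (auto intro: continuous_on_subset)
  then have "bounded (p ` {s..t})" by (rule compact_imp_bounded)
  then obtain M where M: "\<And>r. r \<in> {s..t} \<Longrightarrow> \<bar>p r\<bar> \<le> M"
    by (metis bounded_iff imageI real_norm_def)
  define H where "H r = exp ((1 + M) * r) * ((u r)\<^sup>2 + (u' r)\<^sup>2)" for r
  have "H s \<le> H t"
  proof (rule DERIV_nonneg_imp_nondecreasing[OF s])
    fix r assume r: "s \<le> r" "r \<le> t"
    let ?d = "exp ((1 + M) * r) * ((1 + M) * ((u r)\<^sup>2 + (u' r)\<^sup>2) + 2 * (1 + p r) * u r * u' r)"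
    have "(H has_real_derivative ?d) (at r)"
      unfolding H_def[abs_def]
      by (rule derivative_eq_intros u refl | simp)+ (simp add: power2_eq_square algebra_simps)
    moreover have "\<bar>2 * (1 + p r) * u r * u' r\<bar> \<le> (1 + M) * ((u r)\<^sup>2 + (u' r)\<^sup>2)"
    proof -
      have "\<bar>1 + p r\<bar> \<le> 1 + M" using M[of r] r by auto
      moreover have "\<bar>2 * u r * u' r\<bar> \<le> (u r)\<^sup>2 + (u' r)\<^sup>2"
        using sum_squares_bound[of "\<bar>u r\<bar>" "\<bar>u' r\<bar>"] by (simp add: abs_mult)
      ultimately have "\<bar>1 + p r\<bar> * \<bar>2 * u r * u' r\<bar> \<le> (1 + M) * ((u r)\<^sup>2 + (u' r)\<^sup>2)"
        by (intro mult_mono) auto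
      also have "\<bar>1 + p r\<bar> * \<bar>2 * u r * u' r\<bar> = \<bar>2 * (1 + p r) * u r * u' r\<bar>"
        by (simp only: abs_mult[symmetric] mult_ac)
      finally show ?thesis .
    qed
    then have "0 \<le> ?d" by (intro mult_nonneg_nonneg) auto
    ultimately show "\<exists>d. (H has_real_derivative d) (at r) \<and> 0 \<le> d" by blast
  qed
  then have "(u s)\<^sup>2 + (u' s)\<^sup>2 \<le> 0"
    by (simp add: H_def zero mult_le_0_iff)
  then show ?thesis by (simp add: sum_power2_le_zero_iff)
qed

subsection \<open>The kernel\<close>

locale quartic_kernel_setup =
  fixes a b :: real
  assumes b_pos: "b > 0"
begin

definition arg :: "real \<Rightarrow> real \<Rightarrow> real \<Rightarrow> real" where
  "arg x y z = b\<^sup>2 * (x\<^sup>2 + y\<^sup>2 + z\<^sup>2) + a / (4 * b ^ 4)"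

definition K :: "real \<Rightarrow> real \<Rightarrow> real \<Rightarrow> real" where
  "K x y z = 2 * b\<^sup>2 * exp (2 * b ^ 3 * x * y * z) * Airy_Ai (arg x y z)"

definition K1 :: "real \<Rightarrow> real \<Rightarrow> real \<Rightarrow> real" where
  "K1 x y z = 2 * b\<^sup>2 * exp (2 * b ^ 3 * x * y * z) *
     (2 * b ^ 3 * x * y * Airy_Ai (arg x y z) + 2 * b\<^sup>2 * z * Airy_Ai' (arg x y z))"

text \<open>The second derivative of Ai has been eliminated by Airy's equation, which is where the
  factor \<open>arg x y z\<close> in the coefficient of Ai comes from.\<close>

definition K2 :: "real \<Rightarrow> real \<Rightarrow> real \<Rightarrow> real" where
  "K2 x y z = 2 * b\<^sup>2 * exp (2 * b ^ 3 * x * y * z) *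
     ((4 * b ^ 6 * x\<^sup>2 * y\<^sup>2 + 4 * b ^ 4 * z\<^sup>2 * arg x y z) * Airy_Ai (arg x y z) +
      (8 * b ^ 5 * x * y * z + 2 * b\<^sup>2) * Airy_Ai' (arg x y z))"

definition V :: "real \<Rightarrow> real" where
  "V x = a * x\<^sup>2 + 4 * b ^ 6 * x ^ 4"

lemma arg_swap: "arg x z y = arg x y z"
  by (simp add: arg_def algebra_simps)

text \<open>By this symmetry one computation of derivatives in the last variable also yields those
  in y: they are \<open>K1 x z y\<close> and \<open>K2 x z y\<close>.\<close>

lemma K_swap: "K x z y = K x y z"
  by (simp add: K_def arg_swap mult.commute mult.left_commute)

lemma arg_deriv: "((\<lambda>z. arg x y z) has_real_derivative 2 * b\<^sup>2 * z) (at z)"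
  unfolding arg_def by (auto intro!: derivative_eq_intros)

lemma Ai_arg_deriv:
  "((\<lambda>z. Airy_Ai (arg x y z)) has_real_derivative Airy_Ai' (arg x y z) * (2 * b\<^sup>2 * z)) (at z)"
  "((\<lambda>z. Airy_Ai' (arg x y z)) has_real_derivative arg x y z * Airy_Ai (arg x y z) * (2 * b\<^sup>2 * z)) (at z)"
  by (intro DERIV_chain2[OF Airy_Ai_has_derivative] DERIV_chain2[OF Airy_Ai'_has_derivative] arg_deriv)+

lemma K_deriv: "((\<lambda>z. K x y z) has_real_derivative K1 x y z) (at z)"
  unfolding K_def K1_def
  by (rule derivative_eq_intros Ai_arg_deriv refl)+ (simp add: algebra_simps)

lemma K1_deriv: "((\<lambda>z. K1 x y z) has_real_derivative K2 x y z) (at z)"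
  unfolding K1_def K2_def
  by (rule derivative_eq_intros Ai_arg_deriv refl)+ (simp add: algebra_simps power_numeral_reduce)

lemma K_deriv_mid: "((\<lambda>y. K x y z) has_real_derivative K1 x z y) (at y)"
  using K_deriv[of x z y] by (simp add: K_swap)

text \<open>The coefficient of Ai' in \<open>K2\<close> is symmetric in y and z and cancels. The
  coefficients of Ai differ by (y^2 - z^2) (4 b^4 \<open>arg x y z\<close> - 4 b^6 x^2) = (y^2 -
  z^2) (4 b^6 (y^2 + z^2) + a), which is V y - V z.\<close>

lemma K_pde: "K2 x z y - V y * K x y z = K2 x y z - V z * K x y z"
  using b_pos by (simp add: K2_def K_def V_def arg_swap arg_def field_simps power_numeral_reduce)

section \<open>Continuity and Gaussian decay of the kernel\<close>

lemma continuous_arg [continuous_intros]: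
  "continuous_on S f \<Longrightarrow> continuous_on S g \<Longrightarrow> continuous_on S (\<lambda>s. arg x (f s) (g s))"
  unfolding arg_def by (intro continuous_intros)

lemma continuous_Ai [continuous_intros]:
  "continuous_on S f \<Longrightarrow> continuous_on S (\<lambda>s. Airy_Ai (f s))"
  "continuous_on S f \<Longrightarrow> continuous_on S (\<lambda>s. Airy_Ai' (f s))"
  by (auto intro!: continuous_on_compose2[of UNIV _ S f] DERIV_continuous_on
      DERIV_subset[OF Airy_Ai_has_derivative] DERIV_subset[OF Airy_Ai'_has_derivative])

lemma continuous_K [continuous_intros]:
  assumes "continuous_on S f" "continuous_on S g"
  shows "continuous_on S (\<lambda>s. K x (f s) (g s))" "continuous_on S (\<lambda>s. K1 x (f s) (g s))"
    "continuous_on S (\<lambda>s. K2 x (f s) (g s))"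
  unfolding K_def K1_def K2_def by (intro continuous_intros assms)+

text \<open>In exp (- \<open>arg x y z\<close>) the term b^2 z^2 cancels the weight, while b^2 x^2
  and b^2 y^2 only help. What remains is the constant exp (- a / (4 b^4)).\<close>

lemma exp_bounded_Ai:
  "exp_bounded Y (\<lambda>y z. exp (b\<^sup>2 * z\<^sup>2) * Airy_Ai (arg x y z))"
  "exp_bounded Y (\<lambda>y z. exp (b\<^sup>2 * z\<^sup>2) * Airy_Ai' (arg x y z))"
proof -
  obtain C where C: "C \<ge> 0" "\<And>t. \<bar>Airy_Ai t\<bar> \<le> C * exp (- t)" "\<And>t. \<bar>Airy_Ai' t\<bar> \<le> C * exp (- t)"
    using Airy_Ai_exp_bound by blast
  have *: "\<bar>exp (b\<^sup>2 * z\<^sup>2) * v\<bar> \<le> C * exp (- a / (4 * b ^ 4)) * exp (0 * \<bar>z\<bar>)"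
    if "\<bar>v\<bar> \<le> C * exp (- arg x y z)" for y z v
  proof -
    have "\<bar>exp (b\<^sup>2 * z\<^sup>2) * v\<bar> \<le> exp (b\<^sup>2 * z\<^sup>2) * (C * exp (- arg x y z))"
      using that by (simp add: abs_mult)
    also have "\<dots> = C * exp (b\<^sup>2 * z\<^sup>2 - arg x y z)"
      by (simp add: exp_diff exp_minus field_simps)
    also have "\<dots> \<le> C * exp (- a / (4 * b ^ 4))"
    proof (intro mult_left_mono C(1))
      have "0 \<le> b\<^sup>2 * x\<^sup>2" "0 \<le> b\<^sup>2 * y\<^sup>2" by simp_all
      then show "exp (b\<^sup>2 * z\<^sup>2 - arg x y z) \<le> exp (- a / (4 * b ^ 4))"
        unfolding arg_def distrib_left minus_divide_left[symmetric] exp_le_cancel_iff by linarith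
    qed
    finally show ?thesis by simp
  qed
  show "exp_bounded Y (\<lambda>y z. exp (b\<^sup>2 * z\<^sup>2) * Airy_Ai (arg x y z))"
    "exp_bounded Y (\<lambda>y z. exp (b\<^sup>2 * z\<^sup>2) * Airy_Ai' (arg x y z))"
    using C by (auto intro!: exp_boundedI[of "C * exp (- a / (4 * b ^ 4))" 0] *)
qed

lemma gauss_bounded_Ai_combination:
  assumes "exp_bounded Y g" "exp_bounded Y h"
  shows "gauss_bounded b Y (\<lambda>y z. g y z * Airy_Ai (arg x y z) + h y z * Airy_Ai' (arg x y z))"
proof (rule exp_bounded_imp_gauss_bounded[OF b_pos])
  have "exp_bounded Y (\<lambda>y z. g y z * (exp (b\<^sup>2 * z\<^sup>2) * Airy_Ai (arg x y z)) +
      h y z * (exp (b\<^sup>2 * z\<^sup>2) * Airy_Ai' (arg x y z)))"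
    by (intro exp_bounded_intros exp_bounded_Ai assms)
  then show "exp_bounded Y (\<lambda>y z. exp (b\<^sup>2 * z\<^sup>2) *
      (g y z * Airy_Ai (arg x y z) + h y z * Airy_Ai' (arg x y z)))"
    by (simp add: algebra_simps)
qed

lemma exp_bounded_arg [exp_bounded_intros]: "exp_bounded Y (\<lambda>y z. arg x y z)"
  unfolding arg_def by (intro exp_bounded_intros)

text \<open>The decay is always in z, but the last two items concern the derivatives in y. The
  weight \<open>h\<close> will be \<open>\<psi>\<close>, its derivative, or V times
  \<open>\<psi>\<close>.\<close>

lemma gauss_bounded_K:
  assumes h: "exp_bounded Y h"
  shows "gauss_bounded b Y (\<lambda>y z. h y z * K x y z)"
    "gauss_bounded b Y (\<lambda>y z. h y z * K1 x y z)"
    "gauss_bounded b Y (\<lambda>y z. h y z * K2 x y z)"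
    "gauss_bounded b Y (\<lambda>y z. h y z * K1 x z y)"
    "gauss_bounded b Y (\<lambda>y z. h y z * K2 x z y)"
proof -
  define e where "e y z = h y z * (2 * b\<^sup>2 * exp (2 * b ^ 3 * x * y * z))" for y z
  have e: "exp_bounded Y e"
    unfolding e_def[abs_def] by (intro exp_bounded_intros h)
  show "gauss_bounded b Y (\<lambda>y z. h y z * K x y z)"
    using gauss_bounded_Ai_combination[of Y e "\<lambda>y z. 0" x] e exp_bounded_const
    by (simp add: e_def K_def mult_ac)
  have "gauss_bounded b Y (\<lambda>y z. (e y z * (2 * b ^ 3 * x * y)) * Airy_Ai (arg x y z)
      + (e y z * (2 * b\<^sup>2 * z)) * Airy_Ai' (arg x y z))"
    by (intro gauss_bounded_Ai_combination exp_bounded_intros e)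
  then show "gauss_bounded b Y (\<lambda>y z. h y z * K1 x y z)"
    by (simp add: e_def K1_def algebra_simps)
  have "gauss_bounded b Y (\<lambda>y z. (e y z * (2 * b ^ 3 * x * z)) * Airy_Ai (arg x y z)
      + (e y z * (2 * b\<^sup>2 * y)) * Airy_Ai' (arg x y z))"
    by (intro gauss_bounded_Ai_combination exp_bounded_intros e)
  then show "gauss_bounded b Y (\<lambda>y z. h y z * K1 x z y)"
    by (simp add: e_def K1_def arg_swap algebra_simps)
  have "gauss_bounded b Y (\<lambda>y z. (e y z * (4 * b ^ 6 * x\<^sup>2 * y\<^sup>2 + 4 * b ^ 4 * z\<^sup>2 * arg x y z)) * Airy_Ai (arg x y z)
      + (e y z * (8 * b ^ 5 * x * y * z + 2 * b\<^sup>2)) * Airy_Ai' (arg x y z))"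
    by (intro gauss_bounded_Ai_combination exp_bounded_intros e)
  then show "gauss_bounded b Y (\<lambda>y z. h y z * K2 x y z)"
    by (simp add: e_def K2_def algebra_simps)
  have "gauss_bounded b Y (\<lambda>y z. (e y z * (4 * b ^ 6 * x\<^sup>2 * z\<^sup>2 + 4 * b ^ 4 * y\<^sup>2 * arg x y z)) * Airy_Ai (arg x y z)
      + (e y z * (8 * b ^ 5 * x * y * z + 2 * b\<^sup>2)) * Airy_Ai' (arg x y z))"
    by (intro gauss_bounded_Ai_combination exp_bounded_intros e)
  then show "gauss_bounded b Y (\<lambda>y z. h y z * K2 x z y)"
    by (simp add: e_def K2_def arg_swap algebra_simps)
qed

section \<open>The kernel near z = x at scale 1 / sqrt y\<close>

definition N :: "real \<Rightarrow> real" where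
  "N y = inverse y * exp (- (2 * b ^ 3 / 3) * y ^ 3 - a / (4 * b ^ 3) * y)"

text \<open>The Gaussian cosine integral of \<open>Airy_Ai_scaled\<close> at the point z = x + u /
  sqrt y: all that is left of Ai once its exponential prefactor is removed.\<close>

definition osc :: "real \<Rightarrow> real \<Rightarrow> real \<Rightarrow> real" where
  "osc x y u = (\<integral>\<tau>. exp (- b * \<tau>\<^sup>2) *
     cos (\<tau> * ((b * y)\<^sup>2 - arg x y (x + u / sqrt y)) / sqrt y - \<tau> ^ 3 / (3 * y * sqrt y)) \<partial>lborel)"

text \<open>An identity for every y > 0, so in the limit of large y both convergence and domination
  reduce to those of \<open>osc\<close>.\<close>

lemma K_scaled:
  assumes y: "y > 0"
  shows "K x y (x + u / sqrt y) / N y / sqrt y = b\<^sup>2 / pi * exp (- (b ^ 3) * u\<^sup>2) * osc x y u"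
proof -
  define z where "z = x + u / sqrt y"
  have u2: "u\<^sup>2 = y * (z - x)\<^sup>2"
    using y by (simp add: z_def power_divide)
  \<comment> \<open>The cubes of y combine as 1/3 - 1 = -2/3, and the terms with x and z as - b^3 y
    (x^2 + z^2) + 2 b^3 x y z = - b^3 u^2.\<close>
  have "2 * b ^ 3 * x * y * z + ((b * y) ^ 3 / 3 - b * y * arg x y z) =
      (- (2 * b ^ 3 / 3) * y ^ 3 - a / (4 * b ^ 3) * y) + (- (b ^ 3) * u\<^sup>2)"
    unfolding u2 arg_def using b_pos by (simp add: field_simps power_numeral_reduce)
  then have e: "exp (2 * b ^ 3 * x * y * z) * exp ((b * y) ^ 3 / 3 - b * y * arg x y z) =
      exp (- (2 * b ^ 3 / 3) * y ^ 3 - a / (4 * b ^ 3) * y) * exp (- (b ^ 3) * u\<^sup>2)"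
    by (simp only: exp_add[symmetric])
  have "K x y z = 2 * b\<^sup>2 * (exp (2 * b ^ 3 * x * y * z) * exp ((b * y) ^ 3 / 3 - b * y * arg x y z)) /
      (2 * pi * sqrt y) * osc x y u"
    unfolding K_def osc_def z_def[symmetric] using Airy_Ai_scaled[OF b_pos y, of "arg x y z"] by simp
  also have "\<dots> = N y * sqrt y * (b\<^sup>2 / pi * exp (- (b ^ 3) * u\<^sup>2) * osc x y u)"
    unfolding e N_def using y by (simp add: field_simps)
  finally show ?thesis
    using y by (simp add: z_def N_def)
qed

lemma osc_phase_continuous:
  "continuous_on UNIV (\<lambda>\<tau>. \<tau> * ((b * y)\<^sup>2 - arg x y (x + u / sqrt y)) / sqrt y - \<tau> ^ 3 / (3 * y * sqrt y))"
  unfolding divide_inverse by (intro continuous_intros)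

lemma abs_osc_le: "\<bar>osc x y u\<bar> \<le> sqrt (pi / b)"
  unfolding osc_def using b_pos osc_phase_continuous by (rule abs_gaussian_cos_integral_le)

text \<open>In (b y)^2 - \<open>arg\<close> the squares of y cancel, so for fixed u the linear phase
  is a convergent quantity times tau / sqrt y; the cubic phase tends to 0 as well.\<close>

lemma osc_tendsto: "((\<lambda>y. osc x y u) \<longlongrightarrow> sqrt (pi / b)) at_top"
  unfolding osc_def
proof (rule tendsto_gaussian_cos_integral[OF b_pos osc_phase_continuous])
  fix \<tau> :: real
  have "((\<lambda>y. u / sqrt y) \<longlongrightarrow> 0) at_top" "((\<lambda>y. \<tau> / sqrt y) \<longlongrightarrow> 0) at_top"
    "((\<lambda>y. \<tau> ^ 3 / (3 * y * sqrt y)) \<longlongrightarrow> 0) at_top" by real_asymp+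
  then have "((\<lambda>y. \<tau> / sqrt y * - (b\<^sup>2 * (x\<^sup>2 + (x + u / sqrt y)\<^sup>2) + a / (4 * b ^ 4)) - \<tau> ^ 3 / (3 * y * sqrt y))
      \<longlongrightarrow> 0 * - (b\<^sup>2 * (x\<^sup>2 + (x + 0)\<^sup>2) + a / (4 * b ^ 4)) - 0) at_top"
    by (intro tendsto_intros)
  then show "((\<lambda>y. \<tau> * ((b * y)\<^sup>2 - arg x y (x + u / sqrt y)) / sqrt y - \<tau> ^ 3 / (3 * y * sqrt y)) \<longlongrightarrow> 0) at_top"
    by (simp add: arg_def power_mult_distrib algebra_simps add_divide_distrib diff_divide_distrib)
qed

end

subsection \<open>Eigenfunctions\<close>

locale quartic_eigenfunction = quartic_kernel_setup +
  fixes E :: real and \<psi> \<psi>' :: "real \<Rightarrow> real"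
  assumes \<psi>_deriv: "\<And>x. (\<psi> has_real_derivative \<psi>' x) (at x)"
    and \<psi>'_deriv: "\<And>x. (\<psi>' has_real_derivative (V x - E) * \<psi> x) (at x)"
    and \<psi>_lim: "(\<psi> \<longlongrightarrow> 0) at_top" "(\<psi> \<longlongrightarrow> 0) at_bot"
    and \<psi>_asymp: "\<psi> \<sim>[at_top] N"
begin

lemma continuous_\<psi> [continuous_intros]:
  "continuous_on S f \<Longrightarrow> continuous_on S (\<lambda>s. \<psi> (f s))"
  "continuous_on S f \<Longrightarrow> continuous_on S (\<lambda>s. \<psi>' (f s))"
  by (auto intro!: continuous_on_compose2[of UNIV _ S f] DERIV_continuous_on
      DERIV_subset[OF \<psi>_deriv] DERIV_subset[OF \<psi>'_deriv])

lemma continuous_V [continuous_intros]: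
  "continuous_on S f \<Longrightarrow> continuous_on S (\<lambda>s. V (f s))"
  unfolding V_def by (intro continuous_intros)

lemma \<psi>_bounded:
  obtains C where "C \<ge> 0" "\<And>z. \<bar>\<psi> z\<bar> \<le> C"
proof -
  have "eventually (\<lambda>z. \<bar>\<psi> z\<bar> < 1) at_top" "eventually (\<lambda>z. \<bar>\<psi> z\<bar> < 1) at_bot"
    using \<psi>_lim[THEN tendsto_rabs_zero, THEN order_tendstoD(2), of 1] by auto
  then obtain p q where pq: "\<And>z. z \<ge> p \<Longrightarrow> \<bar>\<psi> z\<bar> < 1" "\<And>z. z \<le> q \<Longrightarrow> \<bar>\<psi> z\<bar> < 1"
    by (auto simp: eventually_at_top_linorder eventually_at_bot_linorder)
  have "bounded (\<psi> ` {q..p})"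
    by (intro compact_imp_bounded compact_continuous_image continuous_intros) auto
  then obtain M where M: "\<And>z. z \<in> {q..p} \<Longrightarrow> \<bar>\<psi> z\<bar> \<le> M"
    by (metis bounded_iff imageI real_norm_def)
  have "\<bar>\<psi> z\<bar> \<le> max 1 M" for z
    using pq[of z] M[of z] by (cases "z \<ge> p"; cases "z \<le> q"; force)
  then show ?thesis by (intro that[of "max 1 M"]) auto
qed

lemma exp_bounded_\<psi> [exp_bounded_intros]: "exp_bounded Y (\<lambda>y z. \<psi> z)"
proof -
  obtain C where "C \<ge> 0" "\<And>z. \<bar>\<psi> z\<bar> \<le> C" by (rule \<psi>_bounded) blast
  then show ?thesis by (intro exp_boundedI[of C 0]) auto
qed

lemma exp_bounded_V [exp_bounded_intros]: "exp_bounded Y (\<lambda>y z. V z)"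
  unfolding V_def by (intro exp_bounded_intros)

text \<open>Growth of the derivative is recovered from the equation: its own derivative (V - E)
  \<open>\<psi>\<close> is exponentially bounded, and the mean value inequality from 0 to z costs
  only a factor |z|. It is needed for the boundary terms of the integration by parts.\<close>

lemma exp_bounded_\<psi>' [exp_bounded_intros]: "exp_bounded Y (\<lambda>y z. \<psi>' z)"
proof -
  have "exp_bounded 0 (\<lambda>y z. (V z - E) * \<psi> z)" by (intro exp_bounded_intros)
  then obtain C m where C: "0 \<le> C" "0 \<le> m" "\<And>z. \<bar>(V z - E) * \<psi> z\<bar> \<le> C * exp (m * \<bar>z\<bar>)"
    by (rule exp_boundedE) (metis abs_zero order_refl)
  have "\<bar>\<psi>' z\<bar> \<le> (\<bar>\<psi>' 0\<bar> + C) * exp ((m + 1) * \<bar>z\<bar>)" for z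
  proof -
    have "norm (\<psi>' z - \<psi>' 0) \<le> C * exp (m * \<bar>z\<bar>) * norm (z - 0)"
    proof (rule field_differentiable_bound)
      show "convex (closed_segment 0 z)" "z \<in> closed_segment 0 z" "0 \<in> closed_segment 0 z" by auto
      show "(\<psi>' has_real_derivative (V s - E) * \<psi> s) (at s within closed_segment 0 z)" for s
        using \<psi>'_deriv by (rule has_field_derivative_at_within)
      show "norm ((V s - E) * \<psi> s) \<le> C * exp (m * \<bar>z\<bar>)" if "s \<in> closed_segment 0 z" for s
      proof -
        have "\<bar>s\<bar> \<le> \<bar>z\<bar>" using that by (auto simp: closed_segment_eq_real_ivl split: if_splits)
        then have "C * exp (m * \<bar>s\<bar>) \<le> C * exp (m * \<bar>z\<bar>)"
          using C by (intro mult_left_mono) (auto intro: mult_left_mono)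
        then show ?thesis using C(3)[of s] by simp
      qed
    qed
    also have "\<dots> \<le> C * exp (m * \<bar>z\<bar>) * exp \<bar>z\<bar>"
    proof (intro mult_left_mono)
      show "norm (z - 0) \<le> exp \<bar>z\<bar>" using exp_ge_add_one_self[of "\<bar>z\<bar>"] unfolding diff_0_right real_norm_def by argo
    qed (use C in auto)
    finally have "\<bar>\<psi>' z\<bar> \<le> \<bar>\<psi>' 0\<bar> * 1 + C * exp ((m + 1) * \<bar>z\<bar>)"
      by (simp add: algebra_simps exp_add)
    also have "\<dots> \<le> \<bar>\<psi>' 0\<bar> * exp ((m + 1) * \<bar>z\<bar>) + C * exp ((m + 1) * \<bar>z\<bar>)"
      using C by (intro add_mono mult_left_mono) auto
    finally show ?thesis by (simp add: algebra_simps)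
  qed
  then show ?thesis using C by (intro exp_boundedI[of "\<bar>\<psi>' 0\<bar> + C" "m + 1"]) auto
qed

section \<open>The transform of the eigenfunction and its identification\<close>

definition F :: "real \<Rightarrow> real \<Rightarrow> real" where
  "F x y = (\<integral>z. \<psi> z * K x y z \<partial>lborel)"

definition F1 :: "real \<Rightarrow> real \<Rightarrow> real" where
  "F1 x y = (\<integral>z. \<psi> z * K1 x z y \<partial>lborel)"

lemma integrable_\<psi>_K: "integrable lborel (\<lambda>z. \<psi> z * K x y z)"
  by (rule gauss_bounded_integrable[OF b_pos gauss_bounded_K(1)[OF exp_bounded_\<psi>] order_refl])
    (intro continuous_intros)

lemma F_deriv: "(F x has_real_derivative F1 x y) (at y)"
  unfolding F_def[abs_def] F1_def
  by (rule has_real_derivative_integral_gauss_bounded[OF b_pos])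
    (intro gauss_bounded_K exp_bounded_intros continuous_intros DERIV_cmult K_deriv_mid)+

lemma F1_deriv: "(F1 x has_real_derivative (V y - E) * F x y) (at y)"
proof -
  have gb: "gauss_bounded b \<bar>y\<bar> (\<lambda>y z. \<psi> z * K x y z)" "gauss_bounded b \<bar>y\<bar> (\<lambda>y z. (V z * \<psi> z) * K x y z)"
    "gauss_bounded b \<bar>y\<bar> (\<lambda>y z. \<psi> z * K2 x y z)" "gauss_bounded b \<bar>y\<bar> (\<lambda>y z. \<psi> z * K2 x z y)"
    "gauss_bounded b \<bar>y\<bar> (\<lambda>y z. \<psi> z * K1 x y z)" "gauss_bounded b \<bar>y\<bar> (\<lambda>y z. \<psi>' z * K x y z)"
    by (intro gauss_bounded_K exp_bounded_intros)+
  have int: "integrable lborel (\<lambda>z. \<psi> z * K x y z)" "integrable lborel (\<lambda>z. (V z * \<psi> z) * K x y z)"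
    "integrable lborel (\<lambda>z. \<psi> z * K2 x y z)" "integrable lborel (\<lambda>z. \<psi> z * K2 x z y)"
    by (rule gauss_bounded_integrable[OF b_pos _ order_refl], rule gb, intro continuous_intros)+
  have lim: "((\<lambda>z. \<psi> z * K1 x y z - \<psi>' z * K x y z) \<longlongrightarrow> 0) G" if "G = at_top \<or> G = at_bot" for G
    using tendsto_diff[OF gauss_bounded_tendsto_0[OF b_pos gb(5) order_refl that]
        gauss_bounded_tendsto_0[OF b_pos gb(6) order_refl that]] by simp
  \<comment> \<open>Green's identity: this is \<open>\<psi>\<close> K_zz - \<open>\<psi>\<close>''
    K, the z-derivative of \<open>\<psi>\<close> K_z - \<open>\<psi>\<close>' K, which vanishes at
    both ends.\<close>
  let ?g = "\<lambda>z. \<psi> z * K2 x y z - ((V z * \<psi> z) * K x y z - E * (\<psi> z * K x y z))"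
  have g0: "(\<integral>z. ?g z \<partial>lborel) = 0 - 0"
  proof (rule integral_FTC_real_line)
    show "((\<lambda>z. \<psi> z * K1 x y z - \<psi>' z * K x y z) has_vector_derivative ?g z) (at z)" for z
      unfolding has_real_derivative_iff_has_vector_derivative[symmetric]
      by (rule derivative_eq_intros \<psi>_deriv \<psi>'_deriv K_deriv K1_deriv refl)+ (simp add: algebra_simps)
    show "continuous_on UNIV ?g" by (intro continuous_intros)
    show "integrable lborel ?g"
      by (intro Bochner_Integration.integrable_diff integrable_mult_right int)
  qed (auto intro: lim)
  have "(\<integral>z. \<psi> z * K2 x z y \<partial>lborel) = (\<integral>z. ?g z + (V y - E) * (\<psi> z * K x y z) \<partial>lborel)"
  proof (rule Bochner_Integration.integral_cong[OF refl])
    fix z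
    have "\<psi> z * K2 x z y = \<psi> z * (K2 x y z - V z * K x y z + V y * K x y z)"
      using K_pde[of x z y] by simp
    then show "\<psi> z * K2 x z y = ?g z + (V y - E) * (\<psi> z * K x y z)"
      by (simp add: algebra_simps)
  qed
  also have "\<dots> = (\<integral>z. ?g z \<partial>lborel) + (\<integral>z. (V y - E) * (\<psi> z * K x y z) \<partial>lborel)"
    by (intro Bochner_Integration.integral_add Bochner_Integration.integrable_diff integrable_mult_right int)
  also have "\<dots> = (V y - E) * F x y"
    unfolding g0 by (simp add: F_def)
  finally have "(\<integral>z. \<psi> z * K2 x z y \<partial>lborel) = (V y - E) * F x y" .
  moreover have "(F1 x has_real_derivative (\<integral>z. \<psi> z * K2 x z y \<partial>lborel)) (at y)"
    unfolding F1_def[abs_def]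
    by (rule has_real_derivative_integral_gauss_bounded[OF b_pos])
      (intro gauss_bounded_K exp_bounded_intros continuous_intros DERIV_cmult K1_deriv)+
  ultimately show ?thesis by simp
qed

text \<open>After z = x + u / sqrt y the integrand is a value of \<open>\<psi>\<close> near x, times
  a fixed Gaussian in u, times \<open>osc\<close>. The first and last factors are bounded and
  converge, so dominated convergence applies.\<close>

lemma F_asymptotics: "((\<lambda>y. F x y / N y) \<longlongrightarrow> \<psi> x) at_top"
proof -
  obtain C where C: "C \<ge> 0" "\<And>z. \<bar>\<psi> z\<bar> \<le> C" by (rule \<psi>_bounded) blast
  let ?s = "\<lambda>y u. \<psi> (x + u / sqrt y) * (K x y (x + u / sqrt y) / N y / sqrt y)"
  let ?f = "\<lambda>u. \<psi> x * (b\<^sup>2 / pi * sqrt (pi / b)) * exp (- (b ^ 3) * u\<^sup>2)"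
  have s_eq: "?s y u = \<psi> (x + u / sqrt y) * (b\<^sup>2 / pi * exp (- (b ^ 3) * u\<^sup>2) * osc x y u)" if "y > 0" for y u
    by (simp only: K_scaled[OF that])
  have b3: "b ^ 3 > 0" using b_pos by simp
  have "((\<lambda>y. \<integral>u. ?s y u \<partial>lborel) \<longlongrightarrow> (\<integral>u. ?f u \<partial>lborel)) at_top"
  proof (rule integral_dominated_convergence_at_top)
    show "integrable lborel (\<lambda>u. C * (b\<^sup>2 / pi * sqrt (pi / b)) * exp (- (b ^ 3) * u\<^sup>2))"
      using b3 by (intro integrable_mult_right integrable_gaussian)
    show "?f \<in> borel_measurable lborel"
      unfolding measurable_lborel2 by (intro borel_measurable_continuous_onI continuous_intros)
    show "?s y \<in> borel_measurable lborel" for y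
      unfolding divide_inverse measurable_lborel2 by (intro borel_measurable_continuous_onI continuous_intros)
    show "AE u in lborel. ((\<lambda>y. ?s y u) \<longlongrightarrow> ?f u) at_top"
    proof (rule AE_I2)
      fix u
      have "((\<lambda>y. u / sqrt y) \<longlongrightarrow> 0) at_top" by real_asymp
      then have "((\<lambda>y. x + u / sqrt y) \<longlongrightarrow> x + 0) at_top" by (intro tendsto_intros)
      then have "((\<lambda>y. \<psi> (x + u / sqrt y)) \<longlongrightarrow> \<psi> x) at_top"
        using isCont_tendsto_compose[OF DERIV_isCont[OF \<psi>_deriv]] by simp
      then have "((\<lambda>y. \<psi> (x + u / sqrt y) * (b\<^sup>2 / pi * exp (- (b ^ 3) * u\<^sup>2) * osc x y u)) \<longlongrightarrow>
          \<psi> x * (b\<^sup>2 / pi * exp (- (b ^ 3) * u\<^sup>2) * sqrt (pi / b))) at_top"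
        by (intro tendsto_intros osc_tendsto)
      moreover have "eventually (\<lambda>y. \<psi> (x + u / sqrt y) * (b\<^sup>2 / pi * exp (- (b ^ 3) * u\<^sup>2) * osc x y u) = ?s y u) at_top"
        using eventually_gt_at_top[of 0] by eventually_elim (simp only: s_eq)
      ultimately have "((\<lambda>y. ?s y u) \<longlongrightarrow> \<psi> x * (b\<^sup>2 / pi * exp (- (b ^ 3) * u\<^sup>2) * sqrt (pi / b))) at_top"
        by (rule Lim_transform_eventually)
      then show "((\<lambda>y. ?s y u) \<longlongrightarrow> ?f u) at_top" by (simp only: mult_ac)
    qed
    show "eventually (\<lambda>y. AE u in lborel. norm (?s y u) \<le> C * (b\<^sup>2 / pi * sqrt (pi / b)) * exp (- (b ^ 3) * u\<^sup>2)) at_top"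
      using eventually_gt_at_top[of 0]
    proof eventually_elim
      case (elim y)
      show ?case
      proof (rule AE_I2)
        fix u
        have "norm (?s y u) = \<bar>\<psi> (x + u / sqrt y)\<bar> * (b\<^sup>2 / pi * exp (- (b ^ 3) * u\<^sup>2) * \<bar>osc x y u\<bar>)"
          unfolding s_eq[OF elim] by (simp add: abs_mult)
        also have "\<dots> \<le> C * (b\<^sup>2 / pi * exp (- (b ^ 3) * u\<^sup>2) * sqrt (pi / b))"
          using C abs_osc_le by (intro mult_mono mult_nonneg_nonneg) auto
        finally show "norm (?s y u) \<le> C * (b\<^sup>2 / pi * sqrt (pi / b)) * exp (- (b ^ 3) * u\<^sup>2)"
          by (simp only: mult_ac)
      qed
    qed
  qed
  also have "(\<integral>u. ?f u \<partial>lborel) = \<psi> x * (b\<^sup>2 / pi * (sqrt (pi / b) * sqrt (pi / b ^ 3)))"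
    by (simp only: integral_mult_right_zero integral_gaussian[OF b3])
  \<comment> \<open>The two Gaussian integrals, over the contour parameter and over u, multiply to
    pi / b^2 and cancel the prefactor b^2 / pi: the limit is \<open>\<psi> x\<close> with constant
    exactly 1.\<close>
  also have "sqrt (pi / b) * sqrt (pi / b ^ 3) = sqrt ((pi / b\<^sup>2)\<^sup>2)"
    unfolding real_sqrt_mult[symmetric] by (simp add: power_divide power2_eq_square power3_eq_cube mult_ac)
  also have "\<psi> x * (b\<^sup>2 / pi * sqrt ((pi / b\<^sup>2)\<^sup>2)) = \<psi> x"
    using b_pos by simp
  finally have "((\<lambda>y. \<integral>u. ?s y u \<partial>lborel) \<longlongrightarrow> \<psi> x) at_top" .
  moreover have "eventually (\<lambda>y. (\<integral>u. ?s y u \<partial>lborel) = F x y / N y) at_top"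
    using eventually_gt_at_top[of 0]
  proof eventually_elim
    case (elim y)
    have "F x y = \<bar>1 / sqrt y\<bar> *\<^sub>R (\<integral>u. \<psi> (x + 1 / sqrt y * u) * K x y (x + 1 / sqrt y * u) \<partial>lborel)"
      unfolding F_def using elim by (intro lborel_integral_real_affine) simp
    also have "\<dots> = (\<integral>u. \<psi> (x + u / sqrt y) * K x y (x + u / sqrt y) \<partial>lborel) / sqrt y"
      using elim by simp
    finally have "F x y = (\<integral>u. \<psi> (x + u / sqrt y) * K x y (x + u / sqrt y) \<partial>lborel) / sqrt y" .
    then show ?case by (simp add: mult.commute)
  qed
  ultimately show ?thesis by (rule Lim_transform_eventually)
qed

text \<open>The Wronskian of \<open>F x\<close> and \<open>\<psi>\<close> is constant; were it non-zero, the slope of \<open>F x / \<psi>\<close> would stay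
  away from 0 and the quotient could not converge.\<close>

lemma F_eq: "F x y = \<psi> x * \<psi> y"
proof -
  define w where "w = F1 x 0 * \<psi> 0 - F x 0 * \<psi>' 0"
  have "((\<lambda>y. F1 x y * \<psi> y - F x y * \<psi>' y) has_real_derivative 0) (at y)" for y
    by (rule derivative_eq_intros F_deriv F1_deriv \<psi>_deriv \<psi>'_deriv refl)+ (simp add: algebra_simps)
  then have wronskian: "F1 x y * \<psi> y - F x y * \<psi>' y = w" for y
    unfolding w_def using DERIV_isconst_all[of "\<lambda>y. F1 x y * \<psi> y - F x y * \<psi>' y" y 0] by blast
  have N_pos: "eventually (\<lambda>y. N y > 0) at_top"
    using eventually_gt_at_top[of 0] by eventually_elim (simp add: N_def)
  then have N_ne: "eventually (\<lambda>y. N y \<noteq> 0) at_top" by eventually_elim simp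
  have \<psi>_N: "((\<lambda>y. \<psi> y / N y) \<longlongrightarrow> 1) at_top"
    using \<psi>_asymp N_ne by (rule asymp_equivD_strong[OF _ eventually_mono]) auto
  have "eventually (\<lambda>y. \<psi> y / N y > 0) at_top"
    using \<psi>_N by (rule order_tendstoD) simp
  with N_pos have \<psi>_pos: "eventually (\<lambda>y. \<psi> y > 0) at_top"
    by eventually_elim (simp add: zero_less_divide_iff)
  define q where "q y = F x y / \<psi> y" for y
  have "((\<lambda>y. (F x y / N y) / (\<psi> y / N y)) \<longlongrightarrow> \<psi> x / 1) at_top"
    by (intro tendsto_intros F_asymptotics \<psi>_N) simp
  moreover have "eventually (\<lambda>y. (F x y / N y) / (\<psi> y / N y) = q y) at_top"
    using N_ne by eventually_elim (simp add: q_def)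
  ultimately have q_lim: "(q \<longlongrightarrow> \<psi> x) at_top"
    using Lim_transform_eventually by force
  \<comment> \<open>The bound 1 makes 1 / (\<open>\<psi> s\<close>)^2 at least 1, so the slope of
    \<open>q\<close> has absolute value at least |w|.\<close>
  have "eventually (\<lambda>y. \<psi> y < 1) at_top"
    using \<psi>_lim(1) by (rule order_tendstoD) simp
  with \<psi>_pos have "eventually (\<lambda>y. 0 < \<psi> y \<and> \<psi> y < 1) at_top"
    by eventually_elim simp
  then obtain Y where Y: "\<And>y. y \<ge> Y \<Longrightarrow> 0 < \<psi> y \<and> \<psi> y < 1"
    by (auto simp: eventually_at_top_linorder)
  have q_deriv: "(q has_real_derivative w / (\<psi> y)\<^sup>2) (at y)" if "y \<ge> Y" for y
    unfolding q_def[abs_def] using Y[OF that]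
    by (auto intro!: derivative_eq_intros F_deriv \<psi>_deriv simp: wronskian[of y, symmetric] power2_eq_square)
  \<comment> \<open>Increments over unit intervals: they tend to 0 because \<open>q\<close>
    converges, yet by the mean value theorem none is below |w|.\<close>
  have step: "\<bar>w\<bar> \<le> \<bar>q (y + 1) - q y\<bar>" if "y \<ge> Y" for y
  proof -
    have "\<exists>s>y. s < y + 1 \<and> q (y + 1) - q y = (y + 1 - y) * (w / (\<psi> s)\<^sup>2)"
      by (rule MVT2) (use q_deriv that in auto)
    then obtain s where s: "y < s" "s < y + 1" "q (y + 1) - q y = (y + 1 - y) * (w / (\<psi> s)\<^sup>2)"
      by blast
    have "0 < (\<psi> s)\<^sup>2" "(\<psi> s)\<^sup>2 \<le> 1"
      using Y[of s] s that by (auto intro: power_le_one)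
    then show ?thesis
      unfolding s(3) by (simp add: le_divide_eq mult_left_le)
  qed
  have "filterlim (\<lambda>y::real. y + 1) at_top at_top" by real_asymp
  from tendsto_diff[OF filterlim_compose[OF q_lim this] q_lim]
  have "((\<lambda>y. \<bar>q (y + 1) - q y\<bar>) \<longlongrightarrow> 0) at_top"
    by (intro tendsto_rabs_zero) simp
  moreover have "eventually (\<lambda>y. \<bar>w\<bar> \<le> \<bar>q (y + 1) - q y\<bar>) at_top"
    using eventually_ge_at_top[of Y] by eventually_elim (rule step)
  ultimately have "\<bar>w\<bar> \<le> 0" by (rule tendsto_lowerbound) simp
  then have w: "w = 0" by simp
  have q_const: "q y = q Y" if "y \<ge> Y" for y
  proof (cases "y = Y")
    case False
    have "\<exists>s>Y. s < y \<and> q y - q Y = (y - Y) * (w / (\<psi> s)\<^sup>2)"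
      by (rule MVT2) (use False q_deriv that in auto)
    then show ?thesis using w by auto
  qed simp
  then have "eventually (\<lambda>y. q y = q Y) at_top"
    unfolding eventually_at_top_linorder by blast
  then have "q Y = \<psi> x"
    using q_lim tendsto_eventually tendsto_unique trivial_limit_at_top_linorder by blast
  then have qY: "q y = \<psi> x" if "y \<ge> Y" for y
    using q_const[OF that] by simp
  have right: "F x y = \<psi> x * \<psi> y" "F1 x y = \<psi> x * \<psi>' y" if "y \<ge> Y" for y
  proof -
    show *: "F x y = \<psi> x * \<psi> y"
      using qY[OF that] Y[OF that] by (simp add: q_def divide_eq_eq)
    show "F1 x y = \<psi> x * \<psi>' y"
      using wronskian[of y] Y[OF that] by (simp add: w *)
  qed
  show ?thesis
  proof (cases "y \<ge> Y")
    case False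
    \<comment> \<open>The difference solves the same linear equation and has zero value and slope at
      \<open>Y\<close>, so it vanishes to the left of \<open>Y\<close> too.\<close>
    have "F x y - \<psi> x * \<psi> y = 0"
    proof (rule linear_ode_zero_left[where u = "\<lambda>y. F x y - \<psi> x * \<psi> y" and t = Y])
      show "((\<lambda>y. F x y - \<psi> x * \<psi> y) has_real_derivative F1 x s - \<psi> x * \<psi>' s) (at s)" for s
        by (intro derivative_intros F_deriv DERIV_cmult \<psi>_deriv)
      show "((\<lambda>y. F1 x y - \<psi> x * \<psi>' y) has_real_derivative (V s - E) * (F x s - \<psi> x * \<psi> s)) (at s)" for s
        by (rule derivative_eq_intros F1_deriv \<psi>'_deriv refl)+ (simp add: algebra_simps)
      show "continuous_on UNIV (\<lambda>s. V s - E)" by (intro continuous_intros)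
      show "F x Y - \<psi> x * \<psi> Y = 0" "F1 x Y - \<psi> x * \<psi>' Y = 0" using right[of Y] by auto
    qed (use False in simp)
    then show ?thesis by simp
  qed (rule right)
qed

end

lemma sixth_root_parametrisation:
  fixes lam :: real
  assumes "lam > 0"
  obtains b where "b > 0" "lam / 2 = 4 * b ^ 6" "sqrt (lam / 2) = 2 * b ^ 3"
    "lam powr (1/3) = 2 * b\<^sup>2" "lam powr (2/3) = 4 * b ^ 4"
proof
  define r where "r = lam powr (1/6)"
  have r: "r > 0" using assms by (simp add: r_def)
  have pow: "r ^ n = lam powr (real n / 6)" for n
    using assms by (simp add: r_def powr_realpow[symmetric] powr_powr)
  \<comment> \<open>The division by sqrt 2 accounts for the 8 in \<open>lam\<close> = 8 b^6.\<close>
  define b where "b = r / sqrt 2"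
  have s: "sqrt 2 ^ 2 = 2" "sqrt 2 ^ 3 = 2 * sqrt 2" "sqrt 2 ^ 4 = 4" "sqrt 2 ^ 6 = (8 :: real)"
    by (simp_all add: power_numeral_reduce)
  show "b > 0" using r by (simp add: b_def)
  show l: "lam / 2 = 4 * b ^ 6"
    using pow[of 6] assms by (simp add: b_def power_divide s)
  have "sqrt (lam / 2) = sqrt ((2 * b ^ 3)\<^sup>2)"
    unfolding l by (simp add: power_mult_distrib)
  also have "\<dots> = 2 * b ^ 3" using \<open>b > 0\<close> by (simp only: real_sqrt_abs) simp
  finally show "sqrt (lam / 2) = 2 * b ^ 3" .
  show "lam powr (1/3) = 2 * b\<^sup>2"
    using pow[of 2] by (simp add: b_def power_divide)
  show "lam powr (2/3) = 4 * b ^ 4"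
    using pow[of 4] by (simp add: b_def power_divide s)
qed

theorem theorem1:
  fixes a lam :: real
  assumes "lam > 0"
  shows "(\<forall>E \<psi>. normalised_eigenfunction a lam E \<psi> \<longrightarrow>
            (\<forall>x y. integrable lborel (\<lambda>z. \<psi> z * quartic_kernel a lam x y z) \<and>
                   \<psi> x * \<psi> y = (\<integral>z. \<psi> z * quartic_kernel a lam x y z \<partial>lborel)))
       \<and> (a > lam powr (2/3) * airy_a1 \<longrightarrow> (\<forall>x y z. quartic_kernel a lam x y z > 0))"
proof (intro conjI impI allI)
  obtain b where b: "b > 0" "lam / 2 = 4 * b ^ 6" "sqrt (lam / 2) = 2 * b ^ 3"
    "lam powr (1/3) = 2 * b\<^sup>2" "lam powr (2/3) = 4 * b ^ 4"
    using sixth_root_parametrisation[OF assms] by blast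
  interpret quartic_kernel_setup a b
    by unfold_locales (rule b)
  have K_eq: "quartic_kernel a lam x y z = K x y z" for x y z
    unfolding quartic_kernel_def K_def arg_def b(3-5) by simp
  {
    fix E \<psi> x y
    assume "normalised_eigenfunction a lam E \<psi>"
    then obtain \<psi>' where \<psi>: "\<And>x. (\<psi> has_real_derivative \<psi>' x) (at x)"
      "\<And>x. (\<psi>' has_real_derivative (a * x^2 + lam/2 * x^4 - E) * \<psi> x) (at x)"
      "(\<psi> \<longlongrightarrow> 0) at_top" "(\<psi> \<longlongrightarrow> 0) at_bot"
      "\<psi> \<sim>[at_top] (\<lambda>x. inverse x * exp (- (sqrt (lam/2) / 3) * x^3 - a / (2 * sqrt (lam/2)) * x))"
      unfolding normalised_eigenfunction_def by blast
    interpret quartic_eigenfunction a b E \<psi> \<psi>'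
    proof unfold_locales
      show "(\<psi>' has_real_derivative (V x - E) * \<psi> x) (at x)" for x
        using \<psi>(2)[of x] unfolding b(2) by (simp add: V_def)
      show "\<psi> \<sim>[at_top] N"
        using \<psi>(5) unfolding b(3) N_def[abs_def] by (simp add: mult.assoc)
    qed (rule \<psi>)+
    show "integrable lborel (\<lambda>z. \<psi> z * quartic_kernel a lam x y z)"
      unfolding K_eq by (rule integrable_\<psi>_K)
    show "\<psi> x * \<psi> y = (\<integral>z. \<psi> z * quartic_kernel a lam x y z \<partial>lborel)"
      unfolding K_eq using F_eq[of x y] by (simp add: F_def)
  }
  fix x y z
  assume "a > lam powr (2/3) * airy_a1"
  then have "airy_a1 < a / (4 * b ^ 4)"
    using b(1) unfolding b(5) by (simp add: field_simps)
  \<comment> \<open>The other terms of \<open>arg\<close> are non-negative, so the whole range of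
    the argument of Ai lies beyond \<open>airy_a1\<close>.\<close>
  also have "\<dots> \<le> arg x y z"
    using b(1) by (simp add: arg_def)
  finally show "quartic_kernel a lam x y z > 0"
    using b(1) Airy_Ai_pos unfolding K_eq K_def by simp
qed

end
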